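(* Let $q\ge 4$ be a prime power and let $V_2$ be a non-degenerate Hermitian surface in $\mathbb{P}^3$ over $\mathbb{F}_{q^2}$. Let $w_1>w_2>\dots>w_7$ denote the seven highest values attained by $|\mathsf{V}(F)\cap V_2|$ as $F$ ranges over all nonzero homogeneous polynomials of degree $3$ in $\mathbb{F}_{q^2}[x_0,x_1,x_2,x_3]$. Then the following statement is false: for each $i\in\{1,\dots,7\}$ there exist nonzero linear homogeneous polynomials $H_1,H_2,H_3\in\mathbb{F}_{q^2}[x_0,x_1,x_2,x_3]$ such that $V(H_1),V(H_2),V(H_3)$ contain a common line and $|\mathsf{V}(H_1H_2H_3)\cap V_2|=w_i$.
   Context: A non-degenerate Hermitian surface $V_2$ is the zero set in $\mathbb{P}^3$ of $x^T A x^{(q)}$, where $x=(x_0,x_1,x_2,x_3)^T$, $x^{(q)}=(x_0^q,x_1^q,x_2^q,x_3^q)^T$, and $A=(a_{ij})$ is an invertible $4\times 4$ matrix over $\mathbb{F}_{q^2}$ with $A^T=A^{(q)}:=(a_{ij}^q)$. $V(F)$ is the zero set of $F$ in $\mathbb{P}^3$ over the algebraic closure, and $\mathsf{V}(F)$ is its set of $\mathbb{F}_{q^2}$-rational points. The statement asserted to be false is the case $d=3$ of a conjecture of Edoukou, Ling and Xing, in which the $2d+1$ highest values are considered for polynomials of degree $d$. *)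

theory Defs
  imports
    "HOL-Analysis.Cartesian_Space"
    "HOL-Algebra.Algebraic_Closure_Type"
    "HOL-Library.Numeral_Type"
    "HOL-Library.Poly_Mapping"
    "HOL-Number_Theory.Prime_Powers"
begin

text \<open>
  A polynomial in variables indexed by \<open>'n\<close> is a finitely supported function from exponent
  vectors to coefficients; its ring structure is the convolution product of
  \<^theory>\<open>HOL-Library.Poly_Mapping\<close>. The numeral type \<open>4\<close> has exactly the elements
  \<open>0, 1, 2, 3\<close>, which serve as the indices of the homogeneous coordinates.
\<close>

type_synonym ('n, 'k) mpoly = "('n \<Rightarrow>\<^sub>0 nat) \<Rightarrow>\<^sub>0 'k"

definition eval_mpoly :: "('n::finite, 'k::comm_semiring_1) mpoly \<Rightarrow> 'k ^ 'n \<Rightarrow> 'k" where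
  "eval_mpoly F x =
     (\<Sum>m\<in>Poly_Mapping.keys F.
        Poly_Mapping.lookup F m * (\<Prod>i\<in>UNIV. x $ i ^ Poly_Mapping.lookup m i))"

text \<open>The zero polynomial is homogeneous of every degree in the following sense.\<close>

definition homogeneous :: "nat \<Rightarrow> ('n::finite, 'k::zero) mpoly \<Rightarrow> bool" where
  "homogeneous d F \<longleftrightarrow> (\<forall>m\<in>Poly_Mapping.keys F. (\<Sum>i\<in>UNIV. Poly_Mapping.lookup m i) = d)"

text \<open>
  Projective points are the one-dimensional subspaces of the coordinate space; a projective line
  is the set of points contained in a two-dimensional subspace.
\<close>

definition proj_points :: "('k::field ^ 'n) set \<Rightarrow> ('k ^ 'n) set set" where
  "proj_points U = {vec.span {x} | x. x \<in> U \<and> x \<noteq> 0}"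

definition proj_line :: "('k::field ^ 'n) set set \<Rightarrow> bool" where
  "proj_line L \<longleftrightarrow> (\<exists>U. vec.subspace U \<and> vec.dim U = 2 \<and> L = proj_points U)"

definition zero_set :: "(4, 'a::field) mpoly \<Rightarrow> ('a alg_closure ^ 4) set set" where
  "zero_set F = proj_points {x. eval_mpoly (Poly_Mapping.map to_ac F) x = 0}"

definition rational_points ::
    "('a::field alg_closure ^ 4) set set \<Rightarrow> ('a alg_closure ^ 4) set set" where
  "rational_points S = {P \<in> S. \<exists>x :: 'a ^ 4. x \<noteq> 0 \<and> P = vec.span {\<chi> i. to_ac (x $ i)}}"

definition rational_zero_set :: "(4, 'a::field) mpoly \<Rightarrow> ('a alg_closure ^ 4) set set" where
  "rational_zero_set F = rational_points (zero_set F)"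

text \<open>
  Meant for a ground field \<open>'a\<close> with \<open>q\<^sup>2\<close> elements. The surface is taken over the algebraic closure;
  it is only ever intersected with sets of rational points.
\<close>

definition nondegenerate_hermitian_surface ::
    "nat \<Rightarrow> ('a::field alg_closure ^ 4) set set \<Rightarrow> bool" where
  "nondegenerate_hermitian_surface q V \<longleftrightarrow>
     (\<exists>A :: 'a ^ 4 ^ 4. invertible A \<and> transpose A = map_matrix (\<lambda>a. a ^ q) A \<and>
        V = proj_points {x. scalar_product x (map_matrix to_ac A *v (\<chi> i. x $ i ^ q)) = 0})"

definition section_sizes ::
    "nat \<Rightarrow> ('a::field alg_closure ^ 4) set set \<Rightarrow> nat set" where
  "section_sizes d V =
     {card (rational_zero_set F \<inter> V) | F :: (4, 'a) mpoly. F \<noteq> 0 \<and> homogeneous d F}"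

text \<open>\<open>w 1 > \<dots> > w n\<close> are the \<open>n\<close> highest elements of \<open>S\<close>; in particular \<open>S\<close> has at least \<open>n\<close> elements.\<close>

definition highest_values :: "nat \<Rightarrow> nat set \<Rightarrow> (nat \<Rightarrow> nat) \<Rightarrow> bool" where
  "highest_values n S w \<longleftrightarrow>
     (\<forall>i\<in>{1..n}. w i \<in> S) \<and>
     (\<forall>i\<in>{1..n}. \<forall>j\<in>{1..n}. i < j \<longrightarrow> w i > w j) \<and>
     (\<forall>s\<in>S - w ` {1..n}. \<forall>i\<in>{1..n}. s < w i)"

end

theory Submission
  imports Defs "HOL-Number_Theory.Residues"
begin

text \<open>
  The disproof exhibits a cubic with many points on the surface whose number of points is a multiple
  of \<open>q\<close>, whereas the large values that come from planes through a common line are congruent to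
  \<open>1\<close> modulo \<open>q\<close>.

  The counts behind this are classical. A line meets the surface in \<open>1\<close>, \<open>q + 1\<close> or \<open>q\<^sup>2 + 1\<close>
  points, a plane in \<open>q\<^sup>3 + 1\<close> points, or in \<open>q\<^sup>3 + q\<^sup>2 + 1\<close> points if it is tangent
  (\<open>line_points\<close>, \<open>plane_points\<close>). They come from a single recursion: if \<open>P\<close> is an anisotropic
  vector of a subspace \<open>W\<close>, then \<open>W\<close> is the orthogonal sum of the span of \<open>P\<close> and its orthogonal
  complement in \<open>W\<close>, and every nonzero value of the form on the complement is cancelled by exactly
  \<open>q + 1\<close> multiples of \<open>P\<close>, because the fibres of the norm \<open>t \<mapsto> t\<^sup>q\<^sup>+\<^sup>1\<close> over the nonzero
  elements of the subfield with \<open>q\<close> elements have size \<open>q + 1\<close> (\<open>isotropic_split\<close>). Nondegeneracy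
  gives every plane a pole and bounds the radical of the form on a plane by dimension one.

  Let three distinct planes share a line with \<open>l\<close> points on the surface, and let \<open>t\<close> of them be
  tangent. Their union has \<open>3 (q\<^sup>3 + 1) + t q\<^sup>2 - 2 l\<close> points on the surface. If this is at least
  \<open>3 q\<^sup>3 + q\<^sup>2 - 3 q\<close>, then it is one of the six numbers \<open>3 q\<^sup>3 + t q\<^sup>2 + 1\<close> and
  \<open>3 q\<^sup>3 + t q\<^sup>2 + 1 - 2 q\<close> with \<open>t \<in> {1, 2, 3}\<close>, all of them congruent to \<open>1\<close> modulo \<open>q\<close>;
  planes that are not distinct give fewer points (\<open>pencil_points\<close>).

  Now take three planes whose only common point \<open>P\<close> is off the surface, one of them tangent. The
  pairwise intersections are lines through \<open>P\<close>, which are not contained in the surface and hence have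
  at most \<open>q + 1\<close> points on it. By inclusion and exclusion the number of points of the union is
  divisible by \<open>q\<close>, since \<open>3 - 3 = 0\<close>, and is at least \<open>3 q\<^sup>3 + q\<^sup>2 - 3 q\<close>
  (\<open>concurrent_planes_points\<close>). So this number \<open>n\<close> is attained by a cubic but not by planes through
  a common line. If all seven highest values came from such planes, \<open>n\<close> would not be among them, so
  all seven would exceed \<open>n\<close> and lie in a set with six elements.

  All counts are carried out with vectors over the ground field: a set of \<open>n\<close> rational points
  corresponds to \<open>n (q\<^sup>2 - 1) + 1\<close> vectors, the zero vector included (\<open>card_section\<close>).
\<close>

(* The component operator of vectors shares its symbol with that of formal power series. *)
unbundle no fps_syntax

section \<open>Finite fields of square order\<close>

text \<open>
  Multiplication by \<open>x\<close> permutes the nonzero elements, so it does not change their product.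
\<close>

lemma finite_field_power_card:
  fixes x :: "'a::{field,finite}"
  shows "x ^ CARD('a) = x"
proof (cases "x = 0")
  case False
  have "(\<Prod>y\<in>UNIV-{0}. y) = (\<Prod>y\<in>UNIV-{0}. x * y)"
    by (rule prod.reindex_bij_witness[of _ "\<lambda>y. x * y" "\<lambda>y. y / x"]) (use False in auto)
  also have "\<dots> = x ^ (CARD('a) - 1) * (\<Prod>y\<in>UNIV-{0}. y)"
    by (simp add: prod.distrib)
  finally have "x ^ (CARD('a) - 1) = 1"
    by simp
  moreover have "CARD('a) = Suc (CARD('a) - 1)"
    by (simp add: Suc_leI finite_UNIV_card_ge_0)
  ultimately show ?thesis
    by (metis mult.right_neutral power_Suc)
qed simp

lemma card_power_eq_le:
  fixes b :: "'a::{field,finite}"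
  assumes "n > 0"
  shows "card {t. t ^ n = b} \<le> n"
proof -
  let ?p = "Polynomial.monom 1 n - [:b:]"
  have "Polynomial.coeff ?p n = 1"
    using assms by (simp add: coeff_pCons split: nat.split)
  then have "?p \<noteq> 0" by (metis coeff_0 zero_neq_one)
  then have "card {t. poly ?p t = 0} \<le> degree ?p"
    by (rule card_poly_roots_bound)
  moreover have "degree ?p \<le> n"
    by (intro degree_diff_le degree_monom_le) simp
  ultimately show ?thesis
    by (simp add: poly_monom)
qed

text \<open>
  The characteristic divides the order of the field, and \<open>q\<close> has only one prime divisor. This is
  what makes the \<open>q\<close>-th power additive.
\<close>

lemma prime_power_is_CHAR_power:
  assumes "primepow q" "CARD('a::{field,finite}) = q ^ 2"
  obtains k where "q = CHAR('a) ^ k" "prime CHAR('a)"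
proof -
  obtain p k where pk: "prime p" "q = p ^ k"
    using assms(1) unfolding primepow_def by auto
  have pr: "prime CHAR('a)"
    by (rule prime_CHAR_semidom) (simp add: finite_imp_CHAR_pos)
  have "CHAR('a) dvd p ^ (k * 2)"
    using CHAR_dvd_CARD[where ?'a = 'a] assms(2) pk by (simp add: power_mult)
  then have "CHAR('a) = p"
    using pr pk(1) by (meson prime_dvd_power primes_dvd_imp_eq)
  with pk pr that show ?thesis by blast
qed

lemma frobenius_add:
  fixes x y :: "'a::{field,finite}"
  assumes "primepow q" "CARD('a) = q ^ 2"
  shows "(x + y) ^ q = x ^ q + y ^ q"
  using prime_power_is_CHAR_power[OF assms] freshmans_dream' by metis

lemma frobenius_sum:
  fixes f :: "'b \<Rightarrow> 'a::{field,finite}"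
  assumes "primepow q" "CARD('a) = q ^ 2"
  shows "(\<Sum>i\<in>I. f i) ^ q = (\<Sum>i\<in>I. f i ^ q)"
  using prime_power_is_CHAR_power[OF assms] freshmans_dream_sum' by metis

lemma frobenius_involution:
  fixes x :: "'a::{field,finite}"
  assumes "CARD('a) = q ^ 2"
  shows "(x ^ q) ^ q = x"
  using finite_field_power_card[of x] assms by (simp add: power_mult power2_eq_square)

text \<open>
  The map \<open>t \<mapsto> t\<^sup>q\<^sup>+\<^sup>1\<close> sends the \<open>q\<^sup>2 - 1\<close> nonzero elements into the roots of
  \<open>c\<^sup>q\<^sup>-\<^sup>1 = 1\<close>. There are at most \<open>q - 1\<close> such roots, and each fibre has at most \<open>q + 1\<close> elements, so
  \<open>q\<^sup>2 - 1 = (q - 1) (q + 1)\<close> forces equality everywhere.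
\<close>

lemma card_norm_fibre:
  fixes b :: "'a::{field,finite}"
  assumes q: "q > 1" "CARD('a) = q ^ 2" and b: "b ^ q = b" "b \<noteq> 0"
  shows "card {t. t ^ Suc q = b} = Suc q"
proof -
  \<comment> \<open>The set \<open>?F\<close> is the multiplicative group of the subfield with
    \<open>q\<close> elements.\<close>
  let ?F = "{b::'a. b ^ (q - 1) = 1}" and ?f = "\<lambda>c::'a. {t. t ^ Suc q = c}"
  have F: "c \<in> ?F \<longleftrightarrow> c ^ q = c \<and> c \<noteq> 0" for c
    using q(1) power_Suc[of c "q - 1"] by (auto simp: power_0_left)
  have cover: "UNIV - {0} = (\<Union>c\<in>?F. ?f c)"
  proof -
    have "t ^ Suc q \<in> ?F" if "t \<noteq> 0" for t
      unfolding F
      using that frobenius_involution[OF q(2), of t] by (simp add: power_mult_distrib mult.commute)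
    moreover have "(0::'a) ^ Suc q \<notin> ?F" using F by simp
    ultimately show ?thesis by auto
  qed
  have "q ^ 2 - 1 = card (UNIV - {0::'a})"
    using q(2) by simp
  also have "\<dots> = (\<Sum>c\<in>?F. card (?f c))"
    unfolding cover by (rule card_UN_disjoint) auto
  finally have total: "(\<Sum>c\<in>?F. card (?f c)) = q ^ 2 - 1" ..
  have bF: "b \<in> ?F" using F b by simp
  have "card ?F \<le> q - 1"
    using card_power_eq_le[of "q - 1"] q(1) by simp
  show ?thesis
  proof (rule antisym)
    show "card (?f b) \<le> Suc q" by (rule card_power_eq_le) simp
    show "Suc q \<le> card (?f b)"
    proof (rule ccontr)
      assume "\<not> ?thesis"
      then have "(\<Sum>c\<in>?F. card (?f c)) < (\<Sum>c\<in>?F. Suc q)"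
        using bF by (intro sum_strict_mono_ex1) (auto intro!: card_power_eq_le simp del: power_Suc)
      also have "\<dots> \<le> (q - 1) * Suc q"
        using mult_le_mono1[OF \<open>card ?F \<le> q - 1\<close>, of "Suc q"] by simp
      also have "\<dots> = q ^ 2 - 1"
        by (simp add: power2_eq_square algebra_simps)
      finally show False using total by simp
    qed
  qed
qed

section \<open>Linear forms and hyperplanes\<close>

lemma scalar_product_add_right: "scalar_product b (x + y) = scalar_product b x + scalar_product b y"
  for b :: "'a::field ^ 'n"
  by (simp add: scalar_product_def algebra_simps sum.distrib)

lemma scalar_product_scale_right: "scalar_product b (t *s x) = t * scalar_product b x"
  for b :: "'a::field ^ 'n"
  by (simp add: scalar_product_def sum_distrib_left mult_ac)

lemma scalar_product_axis: "scalar_product b (axis i 1) = b $ i"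
  for b :: "'a::field ^ 'n::finite"
  by (simp add: scalar_product_def axis_def if_distrib[of "(*) _"] cong: if_cong)

definition hyperplane :: "'a::field ^ 'n \<Rightarrow> ('a ^ 'n) set" where
  "hyperplane b = {x. scalar_product b x = 0}"

lemma subspace_hyperplane: "vec.subspace (hyperplane b)"
  for b :: "'a::field ^ 'n::finite"
  unfolding vec.subspace_def hyperplane_def
  by (auto simp: scalar_product_add_right scalar_product_scale_right)
     (simp add: scalar_product_def)

lemma hyperplane_complement_point:
  fixes b :: "'a::field ^ 'n::finite"
  assumes "b \<noteq> 0"
  obtains P where "scalar_product b P \<noteq> 0"
  using assms scalar_product_axis[of b] by (metis vec_eq_iff zero_index)

text \<open>
  A vector off a hyperplane spans a complement of it. Stated as a bijection, this yields both the
  size of hyperplane sections and the recursion for isotropic vectors.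
\<close>

lemma subspace_split:
  fixes b :: "'a::field ^ 'n::finite"
  assumes W: "vec.subspace W" and P: "P \<in> W" "scalar_product b P \<noteq> 0"
  shows "bij_betw (\<lambda>(t, w). t *s P + w) (UNIV \<times> (W \<inter> hyperplane b)) W"
proof (rule bij_betwI[where g = "\<lambda>x. (scalar_product b x / scalar_product b P,
                                       x - (scalar_product b x / scalar_product b P) *s P)"])
  show "(\<lambda>(t, w). t *s P + w) \<in> UNIV \<times> (W \<inter> hyperplane b) \<rightarrow> W"
    using W P by (auto intro: vec.subspace_add vec.subspace_scale)
  have "scalar_product b (x - (scalar_product b x / scalar_product b P) *s P) = 0" for x
    using P(2) scalar_product_add_right[of b "x - (scalar_product b x / scalar_product b P) *s P"
        "(scalar_product b x / scalar_product b P) *s P"]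
    by (simp add: scalar_product_scale_right)
  then show "(\<lambda>x. (scalar_product b x / scalar_product b P,
      x - (scalar_product b x / scalar_product b P) *s P)) \<in> W \<rightarrow> UNIV \<times> (W \<inter> hyperplane b)"
    using W P by (auto intro: vec.subspace_diff vec.subspace_scale simp: hyperplane_def)
qed (use P in \<open>auto simp: hyperplane_def scalar_product_add_right scalar_product_scale_right\<close>)

lemma card_subspace_hyperplane:
  fixes b :: "'a::{field,finite} ^ 'n::finite"
  assumes "vec.subspace W" "P \<in> W" "scalar_product b P \<noteq> 0"
  shows "card W = CARD('a) * card (W \<inter> hyperplane b)"
  using bij_betw_same_card[OF subspace_split[OF assms]] by (simp add: card_cartesian_product)

lemma hyperplane_subset_imp_multiple:
  fixes b b' :: "'a::field ^ 'n::finite"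
  assumes "b \<noteq> 0" and sub: "hyperplane b \<subseteq> hyperplane b'"
  obtains t where "b' = t *s b"
proof -
  obtain P where P: "scalar_product b P \<noteq> 0"
    using assms(1) hyperplane_complement_point by blast
  define t where "t = scalar_product b' P / scalar_product b P"
  have "scalar_product b' x = t * scalar_product b x" for x
  proof -
    obtain s w where x: "x = s *s P + w" and w: "w \<in> hyperplane b"
      using subspace_split[OF vec.subspace_UNIV UNIV_I P] unfolding bij_betw_def by fast
    show ?thesis
      using w sub P unfolding x t_def hyperplane_def
      by (auto simp: scalar_product_add_right scalar_product_scale_right)
  qed
  then have "b' $ i = t * b $ i" for i
    using scalar_product_axis by metis
  then show ?thesis by (intro that[of t]) (simp add: vec_eq_iff)
qed

section \<open>Hermitian forms\<close>

locale hermitian_matrix =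
  fixes q :: nat and A :: "'a::{field,finite} ^ 'n::finite ^ 'n"
  assumes primepow_q: "primepow q"
    and card_field: "CARD('a) = q ^ 2"
    and inv: "invertible A"
    and hermitian: "transpose A = map_matrix (\<lambda>a. a ^ q) A"
begin

definition conj_vec :: "'a ^ 'n \<Rightarrow> 'a ^ 'n" where
  "conj_vec x = (\<chi> i. x $ i ^ q)"

definition form :: "'a ^ 'n \<Rightarrow> 'a ^ 'n \<Rightarrow> 'a" where
  "form x y = scalar_product (A *v conj_vec y) x"

text \<open>
  The cone over the rational points of the Hermitian variety.
\<close>

definition isotropic :: "('a ^ 'n) set" where
  "isotropic = {x. form x x = 0}"

text \<open>
  The vectors orthogonal to \<open>c\<close> (see \<open>mem_polar\<close>), given by a coefficient vector so that the results
  on hyperplanes apply. For \<open>c = 0\<close> this is the whole space.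
\<close>

definition polar :: "'a ^ 'n \<Rightarrow> ('a ^ 'n) set" where
  "polar c = hyperplane (A *v conj_vec c)"

lemma q_gt_1: "q > 1"
  using primepow_gt_Suc_0[OF primepow_q] by simp

lemma mem_polar: "x \<in> polar c \<longleftrightarrow> form x c = 0"
  by (simp add: polar_def hyperplane_def form_def)

lemma form_add_left: "form (x + y) z = form x z + form y z"
  and form_scale_left: "form (t *s x) z = t * form x z"
  by (simp_all add: form_def scalar_product_add_right scalar_product_scale_right)

lemma hermitian_entry: "A $ i $ j ^ q = A $ j $ i"
proof -
  have "transpose A $ i $ j = map_matrix (\<lambda>a. a ^ q) A $ i $ j"
    using hermitian by simp
  then show ?thesis by (simp add: transpose_def)
qed

lemma form_conj: "form y x = form x y ^ q"
proof -
  have "form x y ^ q = (\<Sum>i\<in>UNIV. \<Sum>j\<in>UNIV. (A $ i $ j * y $ j ^ q * x $ i) ^ q)"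
    unfolding form_def scalar_product_def matrix_vector_mult_def conj_vec_def
    by (simp add: frobenius_sum[OF primepow_q card_field] sum_distrib_right)
  also have "\<dots> = (\<Sum>i\<in>UNIV. \<Sum>j\<in>UNIV. A $ j $ i * y $ j * x $ i ^ q)"
    by (simp only: power_mult_distrib hermitian_entry frobenius_involution[OF card_field])
  also have "\<dots> = (\<Sum>j\<in>UNIV. \<Sum>i\<in>UNIV. A $ j $ i * y $ j * x $ i ^ q)"
    by (rule sum.swap)
  also have "\<dots> = form y x"
    unfolding form_def scalar_product_def matrix_vector_mult_def conj_vec_def
    by (simp add: sum_distrib_left sum_distrib_right mult_ac)
  finally show ?thesis ..
qed

lemma form_eq_0_commute: "form x y = 0 \<longleftrightarrow> form y x = 0"
  using q_gt_1 form_conj[of x y] form_conj[of y x] by (metis power_eq_0_iff)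

lemma form_add_right: "form z (x + y) = form z x + form z y"
  unfolding form_conj[of z] form_add_left by (rule frobenius_add[OF primepow_q card_field])

lemma form_scale_right: "form z (t *s x) = t ^ q * form z x"
  unfolding form_conj[of z] form_scale_left by (rule power_mult_distrib)

lemma conj_vec_involution: "conj_vec (conj_vec x) = x"
  by (simp add: conj_vec_def frobenius_involution[OF card_field])

lemma conj_vec_scale: "conj_vec (t *s x) = t ^ q *s conj_vec x"
  by (simp add: conj_vec_def vec_eq_iff power_mult_distrib)

text \<open>
  Every linear form is represented by a vector through the nondegenerate form, so planes may be
  parametrised by their poles.
\<close>

lemma hyperplane_eq_polar:
  obtains c where "b = A *v conj_vec c"
proof -
  obtain B where "A ** B = mat 1"
    using inv unfolding invertible_def by blast
  then have "A *v conj_vec (conj_vec (B *v b)) = b"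
    by (simp add: conj_vec_involution matrix_vector_mul_assoc)
  then show ?thesis using that by metis
qed

lemma mult_conj_inject: "A *v conj_vec x = A *v conj_vec y \<Longrightarrow> x = y"
proof -
  assume eq: "A *v conj_vec x = A *v conj_vec y"
  obtain B where "B ** A = mat 1"
    using inv unfolding invertible_def by blast
  then have "conj_vec x = conj_vec y"
    using eq by (metis matrix_vector_mul_assoc matrix_vector_mul_lid)
  then show "x = y" by (metis conj_vec_involution)
qed

lemma mult_conj_eq_0_iff: "A *v conj_vec c = 0 \<longleftrightarrow> c = 0"
proof -
  have "A *v conj_vec 0 = 0"
    using q_gt_1 by (simp add: conj_vec_def vec_eq_iff matrix_vector_mult_def power_0_left)
  then show ?thesis using mult_conj_inject by metis
qed

lemma polar_subset_imp_multiple: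
  assumes "c \<noteq> 0" "polar c \<subseteq> polar y"
  obtains t where "y = t *s c"
proof -
  obtain t where "A *v conj_vec y = t *s (A *v conj_vec c)"
    using hyperplane_subset_imp_multiple[of "A *v conj_vec c" "A *v conj_vec y"] assms
    unfolding polar_def mult_conj_eq_0_iff by metis
  also have "\<dots> = A *v conj_vec (t ^ q *s c)"
    by (simp add: conj_vec_scale frobenius_involution[OF card_field] vector_scalar_commute)
  finally show ?thesis using mult_conj_inject that by blast
qed

lemma card_multiples_le: "S \<subseteq> range (\<lambda>t::'a. t *s c) \<Longrightarrow> card S \<le> q ^ 2"
  using card_mono[of "range (\<lambda>t::'a. t *s c)" S] card_image_le[of UNIV "\<lambda>t::'a. t *s c"] card_field
  by simp

text \<open>
  A vector that is orthogonal to all of \<open>polar c\<close> has a polar containing \<open>polar c\<close>, so it is a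
  multiple of \<open>c\<close>. In this form nondegeneracy excludes the sections of too small rank.
\<close>

lemma card_polar_radical:
  assumes "c \<noteq> 0" and "\<And>x y. x \<in> polar c \<Longrightarrow> y \<in> S \<Longrightarrow> form x y = 0"
  shows "card S \<le> q ^ 2"
proof (rule card_multiples_le[of _ c], rule subsetI)
  fix y assume "y \<in> S"
  then have "polar c \<subseteq> polar y"
    using assms(2) by (auto simp: mem_polar)
  then show "y \<in> range (\<lambda>t. t *s c)"
    using polar_subset_imp_multiple[OF assms(1)] by blast
qed

text \<open>
  The dual form of \<open>polar_subset_imp_multiple\<close>: the hyperplanes through \<open>P\<close> have no common vectors
  other than the multiples of \<open>P\<close>.
\<close>

lemma exists_separating_polar:
  assumes P: "P \<noteq> 0" and y: "y \<notin> range (\<lambda>t. t *s P)"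
  obtains d where "P \<in> polar d" "y \<notin> polar d"
proof -
  obtain d where "d \<in> polar P" "d \<notin> polar y"
    using polar_subset_imp_multiple[OF P] y by blast
  then show ?thesis
    using that[of d] form_eq_0_commute[of d] by (simp add: mem_polar)
qed

text \<open>
  Polarisation. If \<open>form x y\<close> were nonzero, then \<open>t * form x y\<close> would run through the whole field, so
  the trace \<open>s + s\<^sup>q\<close> would vanish identically. Then \<open>1 + 1 = 0\<close> and every \<open>s\<close> would satisfy
  \<open>s\<^sup>q = s\<close>, which has too few solutions.
\<close>

lemma totally_isotropic:
  assumes W: "vec.subspace W" and iso: "W \<subseteq> isotropic" and xy: "x \<in> W" "y \<in> W"
  shows "form x y = 0"
proof (rule ccontr)
  assume nz: "form x y \<noteq> 0"
  have tr: "s + s ^ q = 0" for s :: 'a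
  proof -
    \<comment> \<open>With this \<open>t\<close> the two mixed terms of
      \<open>form (t *s x + y) (t *s x + y)\<close> are \<open>s\<close> and its
      conjugate.\<close>
    define t where "t = s / form x y"
    have "t *s x + y \<in> isotropic"
      using W iso xy by (blast intro: vec.subspace_add vec.subspace_scale)
    then have "t * form x y + t ^ q * form y x + (t * t ^ q * form x x + form y y) = 0"
      by (simp add: isotropic_def form_add_left form_add_right form_scale_left form_scale_right
          algebra_simps)
    moreover have "form x x = 0" "form y y = 0"
      using iso xy by (auto simp: isotropic_def)
    moreover have "t * form x y = s" "t ^ q * form y x = s ^ q"
      using nz unfolding form_conj[of y x] t_def by (auto simp flip: power_mult_distrib)
    ultimately show ?thesis by simp
  qed
  have "(1::'a) + 1 = 0" using tr[of 1] by simp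
  then have "s + s = 0" for s :: 'a
    by (metis mult_2 mult_zero_left one_add_one)
  then have "s ^ q = s" for s :: 'a
    using tr[of s] by (metis add_left_cancel)
  then have root: "s ^ (q - 1) = 1" if "s \<noteq> 0" for s :: 'a
    using that q_gt_1 power_Suc[of s "q - 1"] by simp
  have "q ^ 2 - 1 = card (UNIV - {0::'a})"
    using card_field by simp
  also have "\<dots> \<le> card {s::'a. s ^ (q - 1) = 1}"
    using root by (intro card_mono) auto
  also have "\<dots> \<le> q - 1"
    using q_gt_1 by (intro card_power_eq_le) simp
  finally have "q ^ 2 \<le> q" using q_gt_1 by simp
  then show False using q_gt_1 by (simp add: power2_eq_square)
qed

section \<open>Counting isotropic vectors\<close>

lemma card_subspace_polar:
  assumes "vec.subspace W" "P \<in> W" "form P c \<noteq> 0"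
  shows "card W = q ^ 2 * card (W \<inter> polar c)"
  using card_subspace_hyperplane[OF assms(1,2), of "A *v conj_vec c"] assms(3) card_field
  unfolding polar_def form_def by metis

lemma subspace_Int_polar: "vec.subspace W \<Longrightarrow> vec.subspace (W \<inter> polar c)"
  unfolding polar_def by (intro vec.subspace_inter subspace_hyperplane)

lemma subspace_polar: "vec.subspace (polar c)"
  unfolding polar_def by (rule subspace_hyperplane)

lemma card_anisotropic_fibre:
  assumes P: "form P P \<noteq> 0"
  shows "card {t. t ^ Suc q * form P P + form w w = 0} = (if w \<in> isotropic then 1 else Suc q)"
proof -
  define b where "b = - form w w / form P P"
  have eq: "{t. t ^ Suc q * form P P + form w w = 0} = {t. t ^ Suc q = b}"
    using P unfolding b_def by (auto simp: field_simps eq_neg_iff_add_eq_0 simp del: power_Suc)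
  have minus: "(- u) ^ q = - (u ^ q)" for u :: 'a
    using frobenius_add[OF primepow_q card_field, of u "-u"] q_gt_1
    by (simp add: power_0_left eq_neg_iff_add_eq_0 add.commute)
  show ?thesis
  proof (cases "w \<in> isotropic")
    case True
    then have "{t. t ^ Suc q = b} = {0}"
      using P by (auto simp: b_def isotropic_def)
    then show ?thesis using True eq by simp
  next
    case False
    then have "b \<noteq> 0" using P by (simp add: b_def isotropic_def)
    moreover have "b ^ q = b"
      by (simp add: b_def power_divide minus form_conj[symmetric])
    ultimately show ?thesis
      using card_norm_fibre[OF q_gt_1 card_field] False eq by simp
  qed
qed

text \<open>
  In the decomposition \<open>x = t *s P + w\<close> with \<open>w\<close> orthogonal to \<open>P\<close> the vector \<open>x\<close> is isotropic if
  and only if \<open>t\<^sup>q\<^sup>+\<^sup>1 form P P = - form w w\<close>. Every isotropic \<open>w\<close> admits only \<open>t = 0\<close>, and every other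
  \<open>w\<close> admits \<open>q + 1\<close> values of \<open>t\<close>.
\<close>

lemma isotropic_split:
  assumes W: "vec.subspace W" and P: "P \<in> W" "form P P \<noteq> 0"
  shows "card (W \<inter> isotropic) + q * card (W \<inter> polar P \<inter> isotropic) = Suc q * card (W \<inter> polar P)"
proof -
  let ?W = "W \<inter> polar P" and ?f = "\<lambda>(t, w). t *s P + w"
  let ?T = "\<lambda>w. {t. t ^ Suc q * form P P + form w w = 0}"
  have bij: "bij_betw ?f (UNIV \<times> ?W) W"
    using subspace_split[OF W P(1), of "A *v conj_vec P"] P(2) by (simp add: polar_def form_def)
  have iso: "t *s P + w \<in> isotropic \<longleftrightarrow> t \<in> ?T w" if "w \<in> ?W" for t w
  proof -
    have "form w P = 0" "form P w = 0"
      using that form_eq_0_commute by (auto simp: mem_polar)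
    then show ?thesis
      by (simp add: isotropic_def form_add_left form_add_right form_scale_left form_scale_right
          mult_ac)
  qed
  have "?f ` prod.swap ` (SIGMA w:?W. ?T w) = W \<inter> isotropic"
  proof -
    have "prod.swap ` (SIGMA w:?W. ?T w) = {p \<in> UNIV \<times> ?W. ?f p \<in> isotropic}"
      using iso by (auto simp: image_iff simp del: power_Suc)
    moreover have "?f ` {p \<in> S. ?f p \<in> isotropic} = ?f ` S \<inter> isotropic" for S
      by blast
    ultimately show ?thesis
      using bij unfolding bij_betw_def by simp
  qed
  moreover have inj: "inj_on ?f (prod.swap ` (SIGMA w:?W. ?T w))"
    by (rule inj_on_subset[OF bij_betw_imp_inj_on[OF bij]]) auto
  ultimately have "card (W \<inter> isotropic) = card (prod.swap ` (SIGMA w:?W. ?T w))"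
    using card_image[OF inj] by simp
  also have "\<dots> = card (SIGMA w:?W. ?T w)"
    by (rule card_image) simp
  also have "\<dots> = (\<Sum>w\<in>?W. card (?T w))"
    by (rule card_SigmaI) auto
  also have "\<dots> = (\<Sum>w\<in>?W. if w \<in> isotropic then 1 else Suc q)"
    using card_anisotropic_fibre[OF P(2)] by simp
  also have "\<dots> = card (?W \<inter> isotropic) + Suc q * card (?W - isotropic)"
    by (subst sum.If_cases) (auto simp: Diff_eq)
  finally have "card (W \<inter> isotropic) + q * card (?W \<inter> isotropic)
      = Suc q * card (?W \<inter> isotropic) + Suc q * card (?W - isotropic)"
    by simp
  also have "\<dots> = Suc q * card ?W"
    using card_Int_Diff[of ?W isotropic] by (simp flip: distrib_left)
  finally show ?thesis .
qed

lemma zero_isotropic: "0 \<in> isotropic"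
  using form_scale_left[of 0 0 0] by (simp add: isotropic_def)

lemma isotropic_point:
  assumes W: "vec.subspace W" and card: "card W = q ^ 2"
  shows "card (W \<inter> isotropic) = q ^ 2 \<or> card (W \<inter> isotropic) = 1 \<and> W \<inter> isotropic = {0}"
proof (cases "W \<subseteq> isotropic")
  case True
  then show ?thesis using card by (simp add: Int_absorb2)
next
  case False
  then obtain P where P: "P \<in> W" "form P P \<noteq> 0" by (auto simp: isotropic_def)
  have "card (W \<inter> polar P) = 1"
    using card_subspace_polar[OF W P] card q_gt_1 by simp
  moreover have "0 \<in> W \<inter> polar P"
    using subspace_Int_polar[OF W] by (rule vec.subspace_0)
  ultimately have "W \<inter> polar P = {0}"
    by (metis card_1_singletonE singletonD)
  then have "W \<inter> polar P \<inter> isotropic = {0}" using zero_isotropic by auto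
  then have "card (W \<inter> isotropic) = 1"
    using isotropic_split[OF W P] \<open>card (W \<inter> polar P) = 1\<close> by simp
  moreover have "0 \<in> W \<inter> isotropic" using W zero_isotropic vec.subspace_0 by auto
  ultimately show ?thesis by (metis card_1_singletonE singletonD)
qed

text \<open>
  The three cases are the ranks zero, one and two of the form on a two-dimensional subspace. They
  come from one step of \<open>isotropic_split\<close>, which reduces to a subspace of dimension one.
\<close>

lemma isotropic_line_cases:
  assumes W: "vec.subspace W" and card: "card W = q ^ 4"
  obtains (all) "W \<subseteq> isotropic"
    | (tangent) P where "P \<in> W" "form P P \<noteq> 0" "W \<inter> polar P \<subseteq> isotropic"
        "card (W \<inter> isotropic) = q ^ 2"
    | (secant) P where "P \<in> W" "form P P \<noteq> 0" "W \<inter> polar P \<inter> isotropic = {0}"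
        "card (W \<inter> isotropic) + q = q ^ 3 + q ^ 2"
proof (cases "W \<subseteq> isotropic")
  case False
  then obtain P where P: "P \<in> W" "form P P \<noteq> 0" by (auto simp: isotropic_def)
  have "q ^ 2 * card (W \<inter> polar P) = q ^ 2 * q ^ 2"
    using card_subspace_polar[OF W P] card by (simp flip: power_add)
  then have card': "card (W \<inter> polar P) = q ^ 2"
    unfolding mult_cancel_left using q_gt_1 by simp
  consider "card (W \<inter> polar P \<inter> isotropic) = q ^ 2"
    | "card (W \<inter> polar P \<inter> isotropic) = 1" "W \<inter> polar P \<inter> isotropic = {0}"
    using isotropic_point[OF subspace_Int_polar[OF W] card'] by blast
  then show thesis
  proof cases
    case 1
    have "W \<inter> polar P \<inter> isotropic = W \<inter> polar P"
      using 1 card' by (intro card_subset_eq) auto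
    moreover have "card (W \<inter> isotropic) = q ^ 2"
      using isotropic_split[OF W P] 1 card' by (simp add: algebra_simps)
    ultimately show ?thesis using tangent P by blast
  next
    case 2
    have "card (W \<inter> isotropic) + q = q ^ 3 + q ^ 2"
      using isotropic_split[OF W P] 2 card' by (simp add: algebra_simps power3_eq_cube power2_eq_square)
    then show ?thesis using secant P 2 by blast
  qed
qed (use all in blast)

lemma card_isotropic_line:
  assumes "vec.subspace W" "card W = q ^ 4"
  shows "card (W \<inter> isotropic) \<in> {q ^ 4, q ^ 2} \<or> card (W \<inter> isotropic) + q = q ^ 3 + q ^ 2"
  using assms(2) by (cases rule: isotropic_line_cases[OF assms]) (auto simp: Int_absorb2)

text \<open>
  A radical vector \<open>c\<close> would be isotropic and orthogonal to \<open>P\<close> in the secant case.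
\<close>

lemma card_isotropic_degenerate_line:
  assumes W: "vec.subspace W" "card W = q ^ 4"
    and c: "c \<in> W" "c \<noteq> 0" "\<And>x. x \<in> W \<Longrightarrow> form x c = 0"
  shows "card (W \<inter> isotropic) \<in> {q ^ 4, q ^ 2}"
proof (cases rule: isotropic_line_cases[OF W])
  case (3 P)
  have "c \<in> W \<inter> polar P \<inter> isotropic"
    using c 3(1) form_eq_0_commute[of P c] by (simp add: mem_polar isotropic_def)
  then show ?thesis using 3(3) c(2) by simp
qed (use W(2) in \<open>auto simp: Int_absorb2\<close>)

text \<open>
  Two alternatives for the section by the plane with pole \<open>c\<close>: rank two, where the plane is tangent,
  and rank three, which is possible only if \<open>c\<close> is anisotropic. Ranks zero and one are excluded by
  \<open>card_polar_radical\<close>: each of them would produce a radical of dimension at least two.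
\<close>

lemma isotropic_plane:
  assumes c: "c \<noteq> 0" and card: "card (polar c) = q ^ 6"
  shows "card (polar c \<inter> isotropic) + q ^ 3 = q ^ 5 + q ^ 4 \<or>
         form c c \<noteq> 0 \<and> card (polar c \<inter> isotropic) + q ^ 3 = q ^ 5 + q ^ 2"
proof -
  note W = subspace_polar[of c]
  have small: "q ^ 2 < q ^ 4" "q ^ 2 < q ^ 6"
    using q_gt_1 by simp_all
  have "\<not> polar c \<subseteq> isotropic"
  proof
    assume "polar c \<subseteq> isotropic"
    then have "card (polar c) \<le> q ^ 2"
      by (intro card_polar_radical[OF c]) (rule totally_isotropic[OF W])
    then show False using card small by simp
  qed
  then obtain P where P: "P \<in> polar c" "form P P \<noteq> 0" by (auto simp: isotropic_def)
  let ?L = "polar c \<inter> polar P"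
  have L: "vec.subspace ?L" by (rule subspace_Int_polar[OF W])
  have "q ^ 2 * card ?L = q ^ 2 * q ^ 4"
    using card_subspace_polar[OF W P] card by (simp flip: power_add)
  then have card': "card ?L = q ^ 4"
    unfolding mult_cancel_left using q_gt_1 by simp
  \<comment> \<open>If the form vanished on \<open>?L\<close>, then \<open>?L\<close> would be
    orthogonal to itself and to \<open>P\<close>, hence to the whole plane.\<close>
  have notall: "\<not> ?L \<subseteq> isotropic"
  proof
    assume iso: "?L \<subseteq> isotropic"
    have "form x y = 0" if x: "x \<in> polar c" and y: "y \<in> ?L" for x y
    proof -
      obtain t w where "x = t *s P + w" "w \<in> ?L"
        using subspace_split[OF W P(1), of "A *v conj_vec P"] P(2) x
        unfolding bij_betw_def polar_def form_def by fast
      moreover have "form P y = 0"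
        using y form_eq_0_commute[of P y] by (simp add: mem_polar)
      ultimately show ?thesis
        using totally_isotropic[OF L iso] y by (simp add: form_add_left form_scale_left)
    qed
    then have "card ?L \<le> q ^ 2" by (rule card_polar_radical[OF c])
    then show False using card' small by simp
  qed
  have "card (?L \<inter> isotropic) \<noteq> q ^ 4"
  proof
    assume "card (?L \<inter> isotropic) = q ^ 4"
    then have "?L \<inter> isotropic = ?L"
      using card' by (intro card_subset_eq) auto
    then show False using notall by blast
  qed
  note split = isotropic_split[OF W P, unfolded card']
  consider "card (?L \<inter> isotropic) = q ^ 2"
    | "form c c \<noteq> 0" "card (?L \<inter> isotropic) + q = q ^ 3 + q ^ 2"
  proof (cases "form c c = 0")
    case True
    then have "c \<in> ?L"
      using P(1) form_eq_0_commute[of P c] by (simp add: mem_polar)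
    then have "card (?L \<inter> isotropic) \<in> {q ^ 4, q ^ 2}"
      using card_isotropic_degenerate_line[OF L card' _ c] by (simp add: mem_polar)
    then show ?thesis using that \<open>card (?L \<inter> isotropic) \<noteq> q ^ 4\<close> by blast
  next
    case False
    then show ?thesis
      using that card_isotropic_line[OF L card'] \<open>card (?L \<inter> isotropic) \<noteq> q ^ 4\<close> by blast
  qed
  then show ?thesis
  proof cases
    case 1
    then show ?thesis using split by (simp add: algebra_simps eval_nat_numeral)
  next
    case 2
    have "q * (card (?L \<inter> isotropic) + q) = q * (q ^ 3 + q ^ 2)" using 2 by simp
    then have "card (polar c \<inter> isotropic) + q ^ 3 = q ^ 5 + q ^ 2"
      using split by (simp add: algebra_simps eval_nat_numeral)
    then show ?thesis using 2 by simp
  qed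
qed

end

section \<open>Sections of a Hermitian surface by planes\<close>

lemma card_Un3:
  assumes "finite S" "finite T" "finite U"
  shows "card (S \<union> T \<union> U) + (card (S \<inter> T) + card (S \<inter> U) + card (T \<inter> U))
       = card S + card T + card U + card (S \<inter> T \<inter> U)"
proof -
  have "card (S \<union> T) + card (S \<inter> T) = card S + card T"
    using card_Un_Int[of S T] assms by simp
  moreover have "card (S \<union> T \<union> U) + card ((S \<inter> U) \<union> (T \<inter> U)) = card (S \<union> T) + card U"
    using card_Un_Int[of "S \<union> T" U] assms by (simp add: Int_Un_distrib2)
  moreover have "card ((S \<inter> U) \<union> (T \<inter> U)) + card (S \<inter> T \<inter> U) = card (S \<inter> U) + card (T \<inter> U)"
    using card_Un_Int[of "S \<inter> U" "T \<inter> U"] assms by (simp add: Int_ac)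
  ultimately show ?thesis by simp
qed

locale hermitian_surface = hermitian_matrix q A
  for q :: nat and A :: "'a::{field,finite} ^ 4 ^ 4" +
  assumes q_ge_4: "q \<ge> 4"
begin

lemma q_powers: "4 * q \<le> q ^ 2" "4 * q ^ 2 \<le> q ^ 3"
  using q_ge_4 by (simp_all add: power2_eq_square power3_eq_cube)

lemma q2_gt_1: "0 < q ^ 2 - 1"
  using one_less_power[OF q_gt_1, of 2] by simp

text \<open>
  Transfers a count of vectors to a count of points: a set of \<open>p\<close> points is covered by
  \<open>p (q\<^sup>2 - 1) + 1\<close> vectors.
\<close>

lemma point_count_eqI:
  assumes "N + p = p * q ^ 2 + 1"
  shows "N = p * (q ^ 2 - 1) + 1"
proof -
  have "p \<le> p * q ^ 2" using q_gt_1 by simp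
  moreover have "p * (q ^ 2 - 1) = p * q ^ 2 - p" by (simp add: diff_mult_distrib2)
  ultimately show ?thesis using assms by linarith
qed

lemma card_space: "card (UNIV :: ('a ^ 4) set) = q ^ 8"
  using card_field by (simp flip: power_mult)

lemma card_polar:
  assumes "c \<noteq> 0"
  shows "card (polar c) = q ^ 6"
proof -
  obtain P where "form P c \<noteq> 0"
    using hyperplane_complement_point[of "A *v conj_vec c"] assms
    unfolding mult_conj_eq_0_iff form_def by blast
  then have "q ^ 2 * card (polar c) = q ^ 2 * q ^ 6"
    using card_subspace_polar[OF vec.subspace_UNIV UNIV_I] card_space
    by (simp flip: power_add)
  then show ?thesis
    unfolding mult_cancel_left using q_gt_1 by simp
qed

lemma card_Int_polar:
  assumes "vec.subspace W"
  shows "W \<subseteq> polar c \<or> card W = q ^ 2 * card (W \<inter> polar c)"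
  using card_subspace_polar[OF assms] by (metis mem_polar subsetI)

lemma card_line:
  assumes "c \<noteq> 0" "\<not> polar c \<subseteq> polar d"
  shows "card (polar c \<inter> polar d) = q ^ 4"
proof -
  have "q ^ 2 * card (polar c \<inter> polar d) = q ^ 2 * q ^ 4"
    using card_Int_polar[OF subspace_polar, of c d] assms card_polar[of c] by (simp flip: power_add)
  then show ?thesis
    unfolding mult_cancel_left using q_gt_1 by simp
qed

lemma polar_subset_imp_eq:
  assumes "c \<noteq> 0" "d \<noteq> 0" "polar c \<subseteq> polar d"
  shows "polar c = polar d"
  using assms card_polar by (intro card_subset_eq) auto

lemma plane_points:
  assumes "c \<noteq> 0"
  obtains "card (polar c \<inter> isotropic) = (q ^ 3 + q ^ 2 + 1) * (q ^ 2 - 1) + 1"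
    | "form c c \<noteq> 0" "card (polar c \<inter> isotropic) = (q ^ 3 + 1) * (q ^ 2 - 1) + 1"
  using isotropic_plane[OF assms card_polar[OF assms]]
proof (elim disjE conjE)
  assume "card (polar c \<inter> isotropic) + q ^ 3 = q ^ 5 + q ^ 4"
  then have "card (polar c \<inter> isotropic) + (q ^ 3 + q ^ 2 + 1) = (q ^ 3 + q ^ 2 + 1) * q ^ 2 + 1"
    by (simp add: algebra_simps flip: power_add)
  then show ?thesis using point_count_eqI that(1) by blast
next
  assume c: "form c c \<noteq> 0"
  assume "card (polar c \<inter> isotropic) + q ^ 3 = q ^ 5 + q ^ 2"
  then have "card (polar c \<inter> isotropic) + (q ^ 3 + 1) = (q ^ 3 + 1) * q ^ 2 + 1"
    by (simp add: algebra_simps flip: power_add)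
  then show ?thesis using point_count_eqI that(2) c by blast
qed

lemma line_points:
  assumes W: "vec.subspace W" "card W = q ^ 4"
  obtains "W \<subseteq> isotropic" "card (W \<inter> isotropic) = (q ^ 2 + 1) * (q ^ 2 - 1) + 1"
    | "card (W \<inter> isotropic) = 1 * (q ^ 2 - 1) + 1"
    | "card (W \<inter> isotropic) = (q + 1) * (q ^ 2 - 1) + 1"
proof (cases rule: isotropic_line_cases[OF W])
  case 1
  have "card (W \<inter> isotropic) + (q ^ 2 + 1) = (q ^ 2 + 1) * q ^ 2 + 1"
    using 1 W(2) by (simp add: Int_absorb2 algebra_simps flip: power_add)
  then show ?thesis using point_count_eqI that(1) 1 by blast
next
  case (2 P)
  then have "card (W \<inter> isotropic) + 1 = 1 * q ^ 2 + 1" by simp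
  then show ?thesis using point_count_eqI that(2) by blast
next
  case (3 P)
  then have "card (W \<inter> isotropic) + (q + 1) = (q + 1) * q ^ 2 + 1"
    by (simp add: algebra_simps power3_eq_cube power2_eq_square)
  then show ?thesis using point_count_eqI that(3) by blast
qed

text \<open>
  By \<open>line_points\<close> every line meets the surface.
\<close>

lemma exists_isotropic_point:
  obtains c where "c \<noteq> 0" "form c c = 0"
proof -
  obtain c :: "'a ^ 4" where c: "c \<noteq> 0"
    by (metis axis_eq_0_iff zero_neq_one)
  obtain d where d: "d \<noteq> 0" "\<not> polar c \<subseteq> polar d"
  proof -
    have "card (range (\<lambda>t. t *s c)) < card (UNIV :: ('a ^ 4) set)"
    proof -
      have "card (range (\<lambda>t. t *s c)) \<le> q ^ 2" by (rule card_multiples_le[OF order.refl])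
      also have "\<dots> < q ^ 8" using q_gt_1 by simp
      finally show ?thesis using card_space by simp
    qed
    then obtain d where "d \<notin> range (\<lambda>t. t *s c)"
      by (metis UNIV_eq_I nat_neq_iff)
    moreover from this have "d \<noteq> 0"
      by (metis rangeI vector_smult_lzero)
    ultimately show ?thesis
      using polar_subset_imp_multiple[OF c] that by blast
  qed
  let ?L = "polar c \<inter> polar d"
  have L: "vec.subspace ?L" by (rule subspace_Int_polar[OF subspace_polar])
  have "card (?L \<inter> isotropic) \<noteq> 1"
    using one_less_power[OF q_gt_1, of 2]
    by (cases rule: line_points[OF L card_line[OF c d(2)]]) auto
  moreover have "0 \<in> ?L \<inter> isotropic"
    using vec.subspace_0[OF L] zero_isotropic by blast
  ultimately obtain e where "e \<in> ?L \<inter> isotropic" "e \<noteq> 0"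
    by (metis is_singletonI' is_singleton_altdef empty_iff)
  then show ?thesis using that by (auto simp: isotropic_def)
qed

section \<open>Three planes through a point off the surface\<close>

text \<open>
  The condition on the cardinality says that the intersection is one-dimensional, so the three planes
  have exactly the point spanned by \<open>P\<close> in common whenever \<open>P\<close> is nonzero.
\<close>

definition concurrent_planes_through :: "'a ^ 4 \<Rightarrow> 'a ^ 4 \<Rightarrow> 'a ^ 4 \<Rightarrow> 'a ^ 4 \<Rightarrow> bool" where
  "concurrent_planes_through P c d e \<longleftrightarrow> c \<noteq> 0 \<and> d \<noteq> 0 \<and> e \<noteq> 0 \<and>
     P \<in> polar c \<inter> polar d \<inter> polar e \<and> card (polar c \<inter> polar d \<inter> polar e) = q ^ 2"

text \<open>
  The first plane is the tangent plane at an isotropic point \<open>c\<close>. It is not contained in the surface,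
  hence contains an anisotropic \<open>P\<close>. The other two planes pass through \<open>P\<close> and are chosen one after
  the other so that each cuts down the dimension of the intersection.
\<close>

lemma exists_concurrent_planes:
  obtains P c d e where "concurrent_planes_through P c d e" "form P P \<noteq> 0" "form c c = 0"
proof -
  obtain c where c: "c \<noteq> 0" "form c c = 0"
    by (rule exists_isotropic_point)
  have "\<not> polar c \<subseteq> isotropic"
  proof
    assume "polar c \<subseteq> isotropic"
    then have "card (polar c) \<le> q ^ 2"
      by (intro card_polar_radical[OF c(1)]) (rule totally_isotropic[OF subspace_polar])
    then have "q ^ 6 \<le> q ^ 2" using card_polar[OF c(1)] by simp
    then show False using q_gt_1 by simp
  qed
  then obtain P where P: "P \<in> polar c" "form P P \<noteq> 0" by (auto simp: isotropic_def)
  have "P \<noteq> 0" using P(2) zero_isotropic by (auto simp: isotropic_def)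
  have off: "\<exists>y\<in>W. y \<notin> range (\<lambda>t. t *s P)" if "card W > q ^ 2" for W
    using card_multiples_le[of W P] that by fastforce
  have lt: "q ^ 2 < q ^ 6" "q ^ 2 < q ^ 4" using q_gt_1 by simp_all
  obtain y where y: "y \<in> polar c" "y \<notin> range (\<lambda>t. t *s P)"
    using off card_polar[OF c(1)] lt by metis
  obtain d where d: "P \<in> polar d" "y \<notin> polar d"
    using exists_separating_polar[OF \<open>P \<noteq> 0\<close> y(2)] .
  have cd: "card (polar c \<inter> polar d) = q ^ 4"
    using y d by (intro card_line c) blast
  obtain z where z: "z \<in> polar c \<inter> polar d" "z \<notin> range (\<lambda>t. t *s P)"
    using off cd lt by metis
  obtain e where e: "P \<in> polar e" "z \<notin> polar e"
    using exists_separating_polar[OF \<open>P \<noteq> 0\<close> z(2)] .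
  have "q ^ 2 * card (polar c \<inter> polar d \<inter> polar e) = q ^ 2 * q ^ 2"
    using card_Int_polar[OF subspace_Int_polar[OF subspace_polar], of c d e] z(1) e(2) cd
    by (auto simp flip: power_add)
  then have "card (polar c \<inter> polar d \<inter> polar e) = q ^ 2"
    unfolding mult_cancel_left using q_gt_1 by simp
  moreover have "d \<noteq> 0" "e \<noteq> 0"
    using d(2) e(2) q_gt_1 form_eq_0_commute form_scale_left[of 0 0]
    by (auto simp: mem_polar)
  ultimately have "concurrent_planes_through P c d e"
    using P(1) d(1) e(1) c(1) by (simp add: concurrent_planes_through_def)
  then show ?thesis using that P(2) c(2) by blast
qed

text \<open>
  The line passes through \<open>P\<close>, so it is not contained in the surface. That leaves \<open>1\<close> or \<open>q + 1\<close>
  points; the parametrisation \<open>q k + 1\<close> exhibits the residue modulo \<open>q\<close>.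
\<close>

lemma line_through_anisotropic_point:
  assumes "concurrent_planes_through P c d e" "form P P \<noteq> 0"
  obtains k where "k \<le> 1" "card (polar c \<inter> polar d \<inter> isotropic) = (q * k + 1) * (q ^ 2 - 1) + 1"
proof -
  note con = assms(1)[unfolded concurrent_planes_through_def]
  let ?L = "polar c \<inter> polar d"
  have L: "vec.subspace ?L" by (rule subspace_Int_polar[OF subspace_polar])
  have "card ?L = q ^ 4"
  proof -
    have small: "card ?L \<le> q ^ 4"
    proof -
      have "card ?L = q ^ 2 \<or> card ?L = q ^ 4"
        using card_Int_polar[OF L, of e] con by (auto simp: Int_absorb2 simp flip: power_add)
      moreover have "q ^ 2 \<le> q ^ 4" using q_gt_1 by simp
      ultimately show ?thesis by auto
    qed
    have "q ^ 4 < q ^ 6" using q_gt_1 by simp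
    then have "\<not> polar c \<subseteq> polar d"
      using small card_polar[of c] con by (auto simp: Int_absorb2)
    then show ?thesis using card_line con by blast
  qed
  moreover have "\<not> ?L \<subseteq> isotropic"
    using assms con by (auto simp: isotropic_def)
  ultimately show ?thesis
    using L that[of 0] that[of 1] by (elim line_points) auto
qed

lemma concurrent_planes_permute:
  assumes "concurrent_planes_through P c d e"
  shows "concurrent_planes_through P c e d" "concurrent_planes_through P d e c"
proof -
  have "polar c \<inter> polar e \<inter> polar d = polar c \<inter> polar d \<inter> polar e"
    "polar d \<inter> polar e \<inter> polar c = polar c \<inter> polar d \<inter> polar e" by auto
  then show "concurrent_planes_through P c e d" "concurrent_planes_through P d e c"
    using assms unfolding concurrent_planes_through_def by auto
qed

text \<open>
  Inclusion and exclusion with each plane contributing \<open>q a + 1\<close> points, each of the three lines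
  \<open>q k + 1\<close> points with \<open>k \<le> 1\<close>, and the common point \<open>P\<close> contributing none. The constant terms cancel
  and leave a multiple of \<open>q\<close>. The tangent plane accounts for the summand \<open>q\<^sup>2\<close> in the lower bound.
\<close>

lemma concurrent_planes_points:
  obtains c d e n where "c \<noteq> 0" "d \<noteq> 0" "e \<noteq> 0" "q dvd n" "3 * q ^ 3 + q ^ 2 \<le> n + 3 * q"
    "card ((polar c \<union> polar d \<union> polar e) \<inter> isotropic) = n * (q ^ 2 - 1) + 1"
proof -
  obtain P c d e where con: "concurrent_planes_through P c d e" and P: "form P P \<noteq> 0"
    and c: "form c c = 0"
    by (rule exists_concurrent_planes)
  note con' = con[unfolded concurrent_planes_through_def]
  define r where "r = q ^ 2 - 1"
  let ?X = "polar c \<inter> isotropic" and ?Y = "polar d \<inter> isotropic" and ?Z = "polar e \<inter> isotropic"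
  have X: "card ?X = (q * (q ^ 2 + q) + 1) * r + 1"
  proof (rule plane_points[of c])
    show "c \<noteq> 0" using con' by blast
  qed (use c in \<open>auto simp: r_def algebra_simps eval_nat_numeral\<close>)
  have plane: "\<exists>a\<ge>q ^ 2. card (polar f \<inter> isotropic) = (q * a + 1) * r + 1" if "f \<noteq> 0" for f
  proof (cases rule: plane_points[OF that])
    case 1
    then show ?thesis unfolding r_def
      by (intro exI[of _ "q ^ 2 + q"]) (simp add: algebra_simps eval_nat_numeral)
  next
    case 2
    then show ?thesis unfolding r_def
      by (intro exI[of _ "q ^ 2"]) (simp add: algebra_simps eval_nat_numeral)
  qed
  obtain a where Y: "a \<ge> q ^ 2" "card ?Y = (q * a + 1) * r + 1" using plane con' by blast
  obtain b where Z: "b \<ge> q ^ 2" "card ?Z = (q * b + 1) * r + 1" using plane con' by blast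
  obtain k where k: "k \<le> 1" "card (polar c \<inter> polar d \<inter> isotropic) = (q * k + 1) * r + 1"
    using line_through_anisotropic_point[OF con P] unfolding r_def .
  obtain l where l: "l \<le> 1" "card (polar c \<inter> polar e \<inter> isotropic) = (q * l + 1) * r + 1"
    using line_through_anisotropic_point[OF concurrent_planes_permute(1)[OF con] P] unfolding r_def .
  obtain m where m: "m \<le> 1" "card (polar d \<inter> polar e \<inter> isotropic) = (q * m + 1) * r + 1"
    using line_through_anisotropic_point[OF concurrent_planes_permute(2)[OF con] P] unfolding r_def .
  have one: "card (polar c \<inter> polar d \<inter> polar e \<inter> isotropic) = 1"
  proof -
    let ?T = "polar c \<inter> polar d \<inter> polar e"
    have "vec.subspace ?T" by (intro subspace_Int_polar subspace_polar)
    moreover have "card (?T \<inter> isotropic) \<noteq> q ^ 2"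
    proof
      assume "card (?T \<inter> isotropic) = q ^ 2"
      then have "?T \<inter> isotropic = ?T"
        using con' by (intro card_subset_eq) auto
      then show False using con' P by (auto simp: isotropic_def)
    qed
    ultimately show ?thesis using isotropic_point[of ?T] con' by blast
  qed
  \<comment> \<open>The quotient of the point count by \<open>q\<close>.\<close>
  define s where "s = (q ^ 2 + q + a + b) - (k + l + m)"
  have klm: "k + l + m \<le> 3" using k l m by simp
  then have s: "s + (k + l + m) = q ^ 2 + q + a + b"
    using q_ge_4 unfolding s_def by simp
  have sets: "?X \<inter> ?Y = polar c \<inter> polar d \<inter> isotropic" "?X \<inter> ?Z = polar c \<inter> polar e \<inter> isotropic"
    "?Y \<inter> ?Z = polar d \<inter> polar e \<inter> isotropic"
    "polar c \<inter> polar d \<inter> isotropic \<inter> ?Z = polar c \<inter> polar d \<inter> polar e \<inter> isotropic"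
    "?X \<union> ?Y \<union> ?Z = (polar c \<union> polar d \<union> polar e) \<inter> isotropic" by auto
  have "card ((polar c \<union> polar d \<union> polar e) \<inter> isotropic) + q * r * (k + l + m)
      = q * r * (q ^ 2 + q + a + b) + 1"
    using card_Un3[of ?X ?Y ?Z, OF finite finite finite] unfolding sets X Y(2) Z(2) k(2) l(2) m(2) one
    by (simp add: algebra_simps)
  also have "\<dots> = q * s * r + 1 + q * r * (k + l + m)"
    unfolding s[symmetric] by (simp add: algebra_simps)
  finally have "card ((polar c \<union> polar d \<union> polar e) \<inter> isotropic) = q * s * r + 1"
    by simp
  moreover have "3 * q ^ 3 + q ^ 2 \<le> q * s + 3 * q"
  proof -
    have "3 * q ^ 2 + q \<le> s + 3" using s klm Y(1) Z(1) by simp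
    then have "q * (3 * q ^ 2 + q) \<le> q * (s + 3)" by (rule mult_le_mono2)
    then show ?thesis by (simp add: algebra_simps power3_eq_cube power2_eq_square)
  qed
  ultimately show ?thesis
    using that[of c d e "q * s"] con' unfolding r_def by simp
qed

section \<open>Pencils of planes\<close>

text \<open>
  The index \<open>t\<close> is the number of tangent planes when the axis meets the surface in one point (first
  set) or in \<open>q + 1\<close> points (second set). The axis inside the surface gives \<open>3 q\<^sup>3 + q\<^sup>2 + 1\<close>, which is
  already in the first set.
\<close>

definition large_pencil_values :: "nat set" where
  "large_pencil_values =
     (\<lambda>t. 3 * q ^ 3 + t * q ^ 2 + 1) ` {1..3} \<union> (\<lambda>t. 3 * q ^ 3 + t * q ^ 2 + 1 - 2 * q) ` {1..3}"

lemma card_large_pencil_values: "card large_pencil_values \<le> 6"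
proof -
  have le: "card (f ` {1..3}) \<le> 3" for f :: "nat \<Rightarrow> nat"
    using card_image_le[of "{1..3}" f] by simp
  have "card large_pencil_values \<le> 3 + 3"
    unfolding large_pencil_values_def by (rule order_trans[OF card_Un_le add_mono[OF le le]])
  then show ?thesis by simp
qed

lemma mem_large_pencil_values:
  "n \<in> large_pencil_values \<longleftrightarrow>
     (\<exists>t\<in>{1, 2, 3}. n = 3 * q ^ 3 + t * q ^ 2 + 1 \<or> n + 2 * q = 3 * q ^ 3 + t * q ^ 2 + 1)"
proof -
  have "{1..3} = {1, 2, 3::nat}" by auto
  moreover have "n = 3 * q ^ 3 + t * q ^ 2 + 1 - 2 * q \<longleftrightarrow> n + 2 * q = 3 * q ^ 3 + t * q ^ 2 + 1" for t
    using q_powers by linarith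
  ultimately show ?thesis unfolding large_pencil_values_def by blast
qed

text \<open>
  All six values are congruent to \<open>1\<close> modulo \<open>q\<close>.
\<close>

lemma large_pencil_values_not_dvd:
  assumes "n \<in> large_pencil_values"
  shows "\<not> q dvd n"
proof
  assume dvd: "q dvd n"
  obtain t where "n = 3 * q ^ 3 + t * q ^ 2 + 1 \<or> n + 2 * q = 3 * q ^ 3 + t * q ^ 2 + 1"
    using assms unfolding mem_large_pencil_values by blast
  moreover have "q dvd n + 2 * q" using dvd by simp
  ultimately have "q dvd 3 * q ^ 3 + t * q ^ 2 + 1"
    using dvd by (elim disjE) metis+
  moreover have "q dvd 3 * q ^ 3 + t * q ^ 2" by (simp add: eval_nat_numeral)
  ultimately have "q dvd 1" by (meson dvd_add_right_iff)
  then show False using q_gt_1 by simp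
qed

text \<open>
  Two planes have at most \<open>2 (q\<^sup>3 + q\<^sup>2 + 1)\<close> points on the surface, which is below the bound because
  \<open>q\<^sup>3 \<ge> 4 q\<^sup>2\<close> and \<open>q\<^sup>2 \<ge> 4 q\<close>.
\<close>

lemma two_planes_points:
  assumes "c \<noteq> 0" "d \<noteq> 0"
    and n: "card ((polar c \<union> polar d) \<inter> isotropic) = n * (q ^ 2 - 1) + 1"
  shows "n + 3 * q < 3 * q ^ 3 + q ^ 2"
proof -
  define r where "r = q ^ 2 - 1"
  have r: "r > 0" using q2_gt_1 by (simp add: r_def)
  define p where "p = q ^ 3 + q ^ 2 + 1"
  have plane: "card (polar f \<inter> isotropic) \<le> p * r + 1" if "f \<noteq> 0" for f
    unfolding p_def r_def by (cases rule: plane_points[OF that]) auto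
  let ?X = "polar c \<inter> isotropic" and ?Y = "polar d \<inter> isotropic"
  have "0 \<in> ?X \<inter> ?Y"
    using subspace_polar zero_isotropic vec.subspace_0 by blast
  then have "card (?X \<inter> ?Y) > 0" by (auto simp: card_gt_0_iff)
  moreover have "card (?X \<union> ?Y) + card (?X \<inter> ?Y) = card ?X + card ?Y"
    using card_Un_Int[of ?X ?Y] by simp
  moreover have "card (?X \<union> ?Y) = n * r + 1"
    using n by (simp add: r_def Int_Un_distrib2)
  ultimately have "n * r \<le> 2 * (p * r)"
    using plane[OF assms(1)] plane[OF assms(2)] by linarith
  also have "\<dots> = (2 * p) * r" by simp
  finally have "n \<le> 2 * (q ^ 3 + q ^ 2 + 1)"
    using r unfolding p_def by (simp only: mult_le_cancel2)
  then have "n \<le> 2 * q ^ 3 + 2 * q ^ 2 + 2" by simp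
  then show ?thesis using q_powers q_ge_4 by linarith
qed

text \<open>
  The assumptions describe three planes through a common line without requiring them to be distinct.
  Distinct planes meet pairwise in the same line \<open>L\<close>, so the union has \<open>p\<^sub>1 + p\<^sub>2 + p\<^sub>3 - 2 l\<close> points on the
  surface. The claim follows by going through the possible values of \<open>p\<^sub>1\<close>, \<open>p\<^sub>2\<close>, \<open>p\<^sub>3\<close> and \<open>l\<close>.
\<close>

lemma pencil_points:
  assumes nz: "c \<noteq> 0" "d \<noteq> 0" "e \<noteq> 0"
    and pencil: "polar c \<noteq> polar d \<Longrightarrow> polar c \<inter> polar d \<subseteq> polar e"
      "polar c \<noteq> polar e \<Longrightarrow> polar c \<inter> polar e \<subseteq> polar d"
      "polar d \<noteq> polar e \<Longrightarrow> polar d \<inter> polar e \<subseteq> polar c"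
    and n: "card ((polar c \<union> polar d \<union> polar e) \<inter> isotropic) = n * (q ^ 2 - 1) + 1"
  shows "n + 3 * q < 3 * q ^ 3 + q ^ 2 \<or> n \<in> large_pencil_values"
proof (cases "polar c = polar d \<or> polar c = polar e \<or> polar d = polar e")
  case True
  then have "polar c \<union> polar d \<union> polar e \<in> {polar c \<union> polar e, polar c \<union> polar d}"
    by auto
  then show ?thesis using two_planes_points nz n by auto
next
  case False
  define r where "r = q ^ 2 - 1"
  have r: "r > 0" using q2_gt_1 by (simp add: r_def)
  define L where "L = polar c \<inter> polar d"
  have L: "L = polar c \<inter> polar d" "L = polar c \<inter> polar e" "L = polar d \<inter> polar e"
    unfolding L_def using pencil False by auto
  have plane: "\<exists>p\<in>{q ^ 3 + 1, q ^ 3 + q ^ 2 + 1}. card (polar f \<inter> isotropic) = p * r + 1"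
    if "f \<noteq> 0" for f
    unfolding r_def by (cases rule: plane_points[OF that]) auto
  have "vec.subspace L" unfolding L_def by (rule subspace_Int_polar[OF subspace_polar])
  moreover have "card L = q ^ 4"
    unfolding L_def using polar_subset_imp_eq[OF nz(1,2)] False by (intro card_line nz) blast
  ultimately have "\<exists>l\<in>{1, q + 1, q ^ 2 + 1}. card (L \<inter> isotropic) = l * r + 1"
    unfolding r_def by (elim line_points) auto
  then obtain l where l: "l \<in> {1, q + 1, q ^ 2 + 1}" "card (L \<inter> isotropic) = l * r + 1" ..
  let ?X = "polar c \<inter> isotropic" and ?Y = "polar d \<inter> isotropic" and ?Z = "polar e \<inter> isotropic"
  obtain p1 where p1: "p1 \<in> {q ^ 3 + 1, q ^ 3 + q ^ 2 + 1}" "card ?X = p1 * r + 1"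
    using plane[OF nz(1)] ..
  obtain p2 where p2: "p2 \<in> {q ^ 3 + 1, q ^ 3 + q ^ 2 + 1}" "card ?Y = p2 * r + 1"
    using plane[OF nz(2)] ..
  obtain p3 where p3: "p3 \<in> {q ^ 3 + 1, q ^ 3 + q ^ 2 + 1}" "card ?Z = p3 * r + 1"
    using plane[OF nz(3)] ..
  have sets: "?X \<inter> ?Y = L \<inter> isotropic" "?X \<inter> ?Z = L \<inter> isotropic"
    "?Y \<inter> ?Z = L \<inter> isotropic" "L \<inter> isotropic \<inter> ?Z = L \<inter> isotropic"
    "?X \<union> ?Y \<union> ?Z = (polar c \<union> polar d \<union> polar e) \<inter> isotropic"
    using L by auto
  have "(n + 2 * l) * r = (p1 + p2 + p3) * r"
    using card_Un3[of ?X ?Y ?Z, OF finite finite finite] unfolding sets n r_def[symmetric] l(2) p1(2) p2(2) p3(2)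
    by (simp add: algebra_simps)
  then have eq: "n + 2 * l = p1 + p2 + p3" using r by simp
  show ?thesis
    using l(1) p1(1) p2(1) p3(1) eq q_powers q_ge_4 unfolding mem_large_pencil_values
    by (elim insertE emptyE; simp; linarith)
qed

end

section \<open>Evaluation of polynomials\<close>

abbreviation (input) monom_eval :: "('n::finite \<Rightarrow>\<^sub>0 nat) \<Rightarrow> 'k::comm_semiring_1 ^ 'n \<Rightarrow> 'k" where
  "monom_eval m x \<equiv> \<Prod>i\<in>UNIV. x $ i ^ Poly_Mapping.lookup m i"

lemma eval_mpoly_add: "eval_mpoly (F + G) x = eval_mpoly F x + eval_mpoly G x"
  unfolding eval_mpoly_def
  by (rule Poly_Mapping.setsum_keys_plus_distrib[where f = "\<lambda>m c. c * monom_eval m x"])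
     (simp_all add: algebra_simps)

lemma eval_mpoly_sum: "eval_mpoly (\<Sum>i\<in>I. F i) x = (\<Sum>i\<in>I. eval_mpoly (F i) x)"
  by (induction I rule: infinite_finite_induct) (simp_all add: eval_mpoly_add, simp_all add: eval_mpoly_def)

lemma eval_mpoly_single: "eval_mpoly (Poly_Mapping.single m c) x = c * monom_eval m x"
  by (simp add: eval_mpoly_def)

lemma sum_single_keys: "(\<Sum>m\<in>Poly_Mapping.keys F. Poly_Mapping.single m (Poly_Mapping.lookup F m)) = F"
  by (rule poly_mapping_eqI)
     (auto simp: lookup_sum lookup_single when_def in_keys_iff sum.delta' cong: if_cong)

lemma eval_mpoly_mult: "eval_mpoly (F * G) x = eval_mpoly F x * eval_mpoly G x"
  for F G :: "('n::finite, 'k::comm_semiring_1) mpoly"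
proof -
  have "F * G = (\<Sum>m\<in>Poly_Mapping.keys F. \<Sum>n\<in>Poly_Mapping.keys G.
      Poly_Mapping.single (m + n) (Poly_Mapping.lookup F m * Poly_Mapping.lookup G n))"
    by (subst sum_single_keys[of F, symmetric], subst sum_single_keys[of G, symmetric])
       (simp add: sum_product mult_single)
  then show ?thesis
    by (simp add: eval_mpoly_sum eval_mpoly_single lookup_add power_add prod.distrib mult_ac
        eval_mpoly_def[of F] eval_mpoly_def[of G] sum_product)
qed

lemma homogeneous_mult:
  assumes "homogeneous d F" "homogeneous e G"
  shows "homogeneous (d + e) (F * G)"
  using assms keys_mult[of F G] unfolding homogeneous_def
  by (fastforce simp: lookup_add sum.distrib)

lemma eval_mpoly_scale:
  assumes "homogeneous d F"
  shows "eval_mpoly F (t *s x) = t ^ d * eval_mpoly F x"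
proof -
  have "monom_eval m (t *s x) = t ^ d * monom_eval m x" if "m \<in> Poly_Mapping.keys F" for m
    using that assms
    by (simp add: homogeneous_def power_mult_distrib prod.distrib flip: power_sum)
  then show ?thesis
    by (simp add: eval_mpoly_def sum_distrib_left mult_ac)
qed

lemma keys_map_to_ac: "Poly_Mapping.keys (Poly_Mapping.map to_ac F) = Poly_Mapping.keys F"
  by (auto simp: in_keys_iff map.rep_eq when_def)

lemma lookup_map_to_ac: "Poly_Mapping.lookup (Poly_Mapping.map to_ac F) m = to_ac (Poly_Mapping.lookup F m)"
  by (simp add: map.rep_eq when_def)

lemma homogeneous_map_to_ac: "homogeneous d F \<Longrightarrow> homogeneous d (Poly_Mapping.map to_ac F)"
  by (simp add: homogeneous_def keys_map_to_ac)

definition vec_to_ac :: "'a::field ^ 'n \<Rightarrow> 'a alg_closure ^ 'n" where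
  "vec_to_ac x = (\<chi> i. to_ac (x $ i))"

lemma eval_mpoly_map_to_ac:
  "eval_mpoly (Poly_Mapping.map to_ac F) (vec_to_ac x) = to_ac (eval_mpoly F x)"
  by (simp add: eval_mpoly_def keys_map_to_ac lookup_map_to_ac vec_to_ac_def to_ac_sum to_ac_prod)

definition linear_coeffs :: "('n::finite, 'k::comm_semiring_1) mpoly \<Rightarrow> 'k ^ 'n" where
  "linear_coeffs H = (\<chi> i. Poly_Mapping.lookup H (Poly_Mapping.single i 1))"

lemma degree_1_exponent:
  fixes m :: "'n::finite \<Rightarrow>\<^sub>0 nat"
  assumes "(\<Sum>i\<in>UNIV. Poly_Mapping.lookup m i) = 1"
  obtains i where "m = Poly_Mapping.single i 1"
proof -
  obtain i where "Poly_Mapping.lookup m i = 1" "\<And>j. j \<noteq> i \<Longrightarrow> Poly_Mapping.lookup m j = 0"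
    using assms unfolding sum_eq_1_iff[OF finite] by (metis UNIV_I)
  then have "m = Poly_Mapping.single i 1"
    by (intro poly_mapping_eqI) (auto simp: lookup_single when_def)
  then show ?thesis using that by blast
qed

lemma monom_eval_single: "monom_eval (Poly_Mapping.single i 1) x = x $ i"
proof -
  have "monom_eval (Poly_Mapping.single i 1) x = (\<Prod>j\<in>UNIV. if j = i then x $ j else 1)"
    by (rule prod.cong) (auto simp: lookup_single when_def)
  then show ?thesis by simp
qed

lemma eval_mpoly_linear:
  fixes H :: "('n::finite, 'k::comm_semiring_1) mpoly"
  assumes "homogeneous 1 H"
  shows "eval_mpoly H x = scalar_product (linear_coeffs H) x"
proof -
  let ?e = "\<lambda>i::'n. Poly_Mapping.single i (1::nat)"
  have "Poly_Mapping.keys H \<subseteq> range ?e"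
    using assms degree_1_exponent unfolding homogeneous_def by (metis rangeI subsetI)
  then have "eval_mpoly H x = (\<Sum>m\<in>range ?e. Poly_Mapping.lookup H m * monom_eval m x)"
    unfolding eval_mpoly_def by (intro sum.mono_neutral_left) (auto simp: in_keys_iff)
  also have "\<dots> = (\<Sum>i\<in>UNIV. Poly_Mapping.lookup H (?e i) * monom_eval (?e i) x)"
  proof (subst sum.reindex)
    show "inj ?e"
    proof (rule injI)
      fix i j :: 'n
      assume "?e i = ?e j"
      then have "Poly_Mapping.keys (?e i) = Poly_Mapping.keys (?e j)" by (rule arg_cong)
      then show "i = j" by simp
    qed
  qed simp
  also have "\<dots> = scalar_product (linear_coeffs H) x"
    by (simp add: scalar_product_def linear_coeffs_def monom_eval_single[simplified])
  finally show ?thesis .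
qed

lemma linear_coeffs_nonzero:
  assumes "homogeneous 1 H" "H \<noteq> 0"
  shows "linear_coeffs H \<noteq> 0"
proof -
  obtain m where m: "m \<in> Poly_Mapping.keys H"
    using assms(2) by (metis all_not_in_conv keys_eq_empty)
  then obtain i where "m = Poly_Mapping.single i 1"
    using assms(1) degree_1_exponent unfolding homogeneous_def by metis
  then show ?thesis
    using m by (auto simp: linear_coeffs_def vec_eq_iff in_keys_iff)
qed

lemma linear_coeffs_map_to_ac: "linear_coeffs (Poly_Mapping.map to_ac H) = vec_to_ac (linear_coeffs H)"
  by (simp add: linear_coeffs_def vec_to_ac_def lookup_map_to_ac)

lemma exists_linear_mpoly:
  fixes b :: "'k::comm_semiring_1 ^ 'n::finite"
  obtains H where "homogeneous 1 H" "\<And>x. eval_mpoly H x = scalar_product b x"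
proof
  let ?H = "\<Sum>i\<in>UNIV. Poly_Mapping.single (Poly_Mapping.single i (1::nat)) (b $ i)"
  show "eval_mpoly ?H x = scalar_product b x" for x
    by (simp add: eval_mpoly_sum eval_mpoly_single monom_eval_single[simplified] scalar_product_def)
  have "Poly_Mapping.keys ?H \<subseteq> range (\<lambda>i. Poly_Mapping.single i 1)"
    using keys_sum[of "\<lambda>i. Poly_Mapping.single (Poly_Mapping.single i (1::nat)) (b $ i)" UNIV]
    by (auto split: if_splits)
  moreover have "(\<Sum>j\<in>UNIV. Poly_Mapping.lookup (Poly_Mapping.single i (1::nat)) j) = 1" for i :: 'n
    by (simp add: lookup_single when_def)
  ultimately show "homogeneous 1 ?H"
    unfolding homogeneous_def by auto
qed

section \<open>Projective points and lines\<close>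

lemma vec_to_ac_scale: "vec_to_ac (t *s x) = to_ac t *s vec_to_ac x"
  by (simp add: vec_to_ac_def vec_eq_iff)

lemma vec_to_ac_eq_iff: "vec_to_ac x = vec_to_ac y \<longleftrightarrow> x = y"
  by (simp add: vec_to_ac_def vec_eq_iff)

lemma vec_to_ac_eq_0_iff: "vec_to_ac x = 0 \<longleftrightarrow> x = 0"
  by (simp add: vec_to_ac_def vec_eq_iff)

lemma scalar_product_vec_to_ac: "scalar_product (vec_to_ac b) (vec_to_ac x) = to_ac (scalar_product b x)"
  by (simp add: scalar_product_def vec_to_ac_def to_ac_sum)

lemma span_singleton_eq:
  fixes x y :: "'k::field ^ 'n::finite"
  assumes "vec.span {x} = vec.span {y}" "y \<noteq> 0"
  obtains t where "t \<noteq> 0" "y = t *s x"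
proof -
  have "y \<in> vec.span {x}" using assms(1) by (simp add: vec.span_base)
  then obtain t where "y = t *s x" by (auto simp: vec.span_singleton)
  then show ?thesis using that assms(2) by force
qed

lemma span_singleton_scale: "t \<noteq> 0 \<Longrightarrow> vec.span {t *s x} = vec.span {x}"
  for x :: "'k::field ^ 'n::finite"
proof -
  assume t: "t \<noteq> 0"
  have "inverse t *s (t *s x) = x"
    using t by (simp add: vec_eq_iff)
  then have "x \<in> vec.span {t *s x}"
    using vec.span_scale[OF vec.span_base, of "t *s x" "{t *s x}" "inverse t"] by simp
  then show ?thesis
    by (intro vec.span_eq[THEN iffD2]) (simp add: vec.span_base vec.span_scale)
qed

text \<open>
  Two rational vectors that are proportional over the algebraic closure are proportional over the
  ground field: the factor is a quotient of two components.
\<close>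

lemma span_vec_to_ac_eq_iff:
  assumes "x \<noteq> 0" "y \<noteq> 0"
  shows "vec.span {vec_to_ac x} = vec.span {vec_to_ac y} \<longleftrightarrow> y \<in> (\<lambda>t. t *s x) ` (UNIV - {0})"
proof
  assume "vec.span {vec_to_ac x} = vec.span {vec_to_ac y}"
  then obtain s where s: "s \<noteq> 0" "vec_to_ac y = s *s vec_to_ac x"
    using span_singleton_eq assms(2) vec_to_ac_eq_0_iff by metis
  obtain i where i: "x $ i \<noteq> 0" using assms(1) by (auto simp: vec_eq_iff)
  have "to_ac (y $ i) = s * to_ac (x $ i)"
    using s(2) by (simp add: vec_to_ac_def vec_eq_iff)
  then have st: "s = to_ac (y $ i / x $ i)" using i by simp
  then have "y = (y $ i / x $ i) *s x"
    using s(2) by (metis vec_to_ac_scale vec_to_ac_eq_iff)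
  moreover have "y $ i / x $ i \<noteq> 0" using s(1) st by auto
  ultimately show "y \<in> (\<lambda>t. t *s x) ` (UNIV - {0})" by blast
next
  assume "y \<in> (\<lambda>t. t *s x) ` (UNIV - {0})"
  then show "vec.span {vec_to_ac x} = vec.span {vec_to_ac y}"
    by (auto simp: vec_to_ac_scale span_singleton_scale)
qed

text \<open>
  Every projective point with a rational representative has \<open>CARD('a) - 1\<close> of them.
\<close>

lemma card_span_image:
  fixes S :: "('a::{field,finite} ^ 'n::finite) set"
  assumes S: "0 \<notin> S" "\<And>t x. t \<noteq> 0 \<Longrightarrow> x \<in> S \<Longrightarrow> t *s x \<in> S"
  shows "card S = card ((\<lambda>x. vec.span {vec_to_ac x}) ` S) * (CARD('a) - 1)"
proof -
  let ?f = "\<lambda>x. vec.span {vec_to_ac x}"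
  have fibre: "card {y \<in> S. ?f y = ?f x} = CARD('a) - 1" if x: "x \<in> S" for x
  proof -
    have "x \<noteq> 0" using x S(1) by auto
    have "{y \<in> S. ?f y = ?f x} = (\<lambda>t. t *s x) ` (UNIV - {0})"
    proof (intro equalityI subsetI)
      fix y assume "y \<in> {y \<in> S. ?f y = ?f x}"
      moreover from this have "y \<noteq> 0" using S(1) by auto
      ultimately show "y \<in> (\<lambda>t. t *s x) ` (UNIV - {0})"
        using span_vec_to_ac_eq_iff[OF \<open>x \<noteq> 0\<close>, of y] by simp
    next
      fix y assume y: "y \<in> (\<lambda>t. t *s x) ` (UNIV - {0})"
      then have "y \<in> S" using S(2) x by blast
      moreover from this have "y \<noteq> 0" using S(1) by auto
      ultimately show "y \<in> {y \<in> S. ?f y = ?f x}"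
        using span_vec_to_ac_eq_iff[OF \<open>x \<noteq> 0\<close>, of y] y by simp
    qed
    moreover have "inj_on (\<lambda>t. t *s x) (UNIV - {0})"
      using \<open>x \<noteq> 0\<close> by (auto simp: inj_on_def)
    ultimately show ?thesis by (simp add: card_image)
  qed
  have "(\<Sum>P\<in>?f ` S. card {y \<in> S. ?f y = P}) = (\<Sum>P\<in>?f ` S. CARD('a) - 1)"
    by (rule sum.cong) (use fibre in auto)
  moreover have "card S = (\<Sum>P\<in>?f ` S. card {y \<in> S. ?f y = P})"
    using sum.image_gen[of S "\<lambda>_. 1::nat" ?f] by simp
  ultimately show ?thesis by simp
qed

text \<open>
  Adjoining \<open>x\<close> to \<open>U\<close> gives a three-dimensional space inside both \<open>hyperplane b\<close> and \<open>hyperplane c\<close>,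
  which must be all of \<open>hyperplane b\<close>.
\<close>

lemma line_in_planes:
  fixes b c d :: "'k::field ^ 4"
  assumes U: "vec.subspace U" "vec.dim U = 2"
    and sub: "U \<subseteq> hyperplane b" "U \<subseteq> hyperplane c" "U \<subseteq> hyperplane d"
    and b: "b \<noteq> 0"
    and x: "x \<in> hyperplane b" "x \<in> hyperplane c" "x \<notin> hyperplane d"
  shows "hyperplane b \<subseteq> hyperplane c"
proof -
  let ?T = "vec.span (insert x U)"
  have "x \<notin> vec.span U" using vec.span_minimal[OF sub(3) subspace_hyperplane] x(3) by blast
  then have dimT: "vec.dim ?T = 3" using U(2) by (simp add: vec.dim_insert)
  have Tb: "?T \<subseteq> hyperplane b" and Tc: "?T \<subseteq> hyperplane c"
    using x sub by (intro vec.span_minimal subspace_hyperplane; blast)+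
  have "hyperplane b \<noteq> UNIV"
    using hyperplane_complement_point[OF b] by (auto simp: hyperplane_def)
  then have "vec.span (hyperplane b) \<subset> vec.span UNIV"
    unfolding vec.span_eq_iff[THEN iffD2, OF subspace_hyperplane] vec.span_UNIV by blast
  then have "vec.dim (hyperplane b) < vec.dim (UNIV :: ('k ^ 4) set)"
    by (rule vec.dim_psubset)
  then have "vec.dim (hyperplane b) < 4"
    unfolding vec_dim_card by simp
  then have "?T = hyperplane b"
    using Tb dimT by (intro vec.subspace_dim_equal) (auto intro: subspace_hyperplane)
  then show ?thesis using Tc by simp
qed

lemma zero_set_linear:
  assumes "homogeneous 1 H"
  shows "zero_set H = proj_points (hyperplane (vec_to_ac (linear_coeffs H)))"
  using eval_mpoly_linear[OF homogeneous_map_to_ac[OF assms]]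
  by (simp add: zero_set_def hyperplane_def linear_coeffs_map_to_ac)

lemma proj_points_subset_imp:
  assumes "proj_points U \<subseteq> proj_points W" "vec.subspace W"
  shows "U \<subseteq> W"
proof
  fix u assume u: "u \<in> U"
  show "u \<in> W"
  proof (cases "u = 0")
    case False
    then obtain y where y: "y \<in> W" "vec.span {u} = vec.span {y}"
      using u assms(1) unfolding proj_points_def by blast
    then have "vec.span {u} \<subseteq> W" using assms(2) by (simp add: vec.span_minimal)
    then show ?thesis by (meson insertI1 subsetD vec.span_base)
  qed (use assms(2) vec.subspace_0 in auto)
qed

text \<open>
  The common line is only given over the algebraic closure. Two different planes through it meet in
  this line alone, so the third plane contains the rational vectors of their intersection.
\<close>

lemma rational_common_line:
  fixes H1 H2 H3 :: "(4, 'a::field) mpoly"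
  assumes hom: "homogeneous 1 H1" "homogeneous 1 H2" "homogeneous 1 H3"
    and nz: "H1 \<noteq> 0" "H2 \<noteq> 0"
    and L: "proj_line L" "L \<subseteq> zero_set H1 \<inter> zero_set H2 \<inter> zero_set H3"
    and ne: "hyperplane (linear_coeffs H1) \<noteq> hyperplane (linear_coeffs H2)"
  shows "hyperplane (linear_coeffs H1) \<inter> hyperplane (linear_coeffs H2) \<subseteq> hyperplane (linear_coeffs H3)"
proof (rule ccontr)
  let ?b = "\<lambda>H. vec_to_ac (linear_coeffs H)"
  have rat: "vec_to_ac x \<in> hyperplane (?b H) \<longleftrightarrow> x \<in> hyperplane (linear_coeffs H)" for x and H :: "(4, 'a) mpoly"
    by (simp add: hyperplane_def scalar_product_vec_to_ac)
  assume "\<not> ?thesis"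
  then obtain x where x: "vec_to_ac x \<in> hyperplane (?b H1)" "vec_to_ac x \<in> hyperplane (?b H2)"
    "vec_to_ac x \<notin> hyperplane (?b H3)"
    unfolding rat by blast
  obtain U where U: "vec.subspace U" "vec.dim U = 2" "L = proj_points U"
    using L(1) unfolding proj_line_def by blast
  have sub: "U \<subseteq> hyperplane (?b H1)" "U \<subseteq> hyperplane (?b H2)" "U \<subseteq> hyperplane (?b H3)"
    using L(2) unfolding U(3) zero_set_linear[OF hom(1)] zero_set_linear[OF hom(2)] zero_set_linear[OF hom(3)]
    by (intro proj_points_subset_imp subspace_hyperplane; blast)+
  have "?b H1 \<noteq> 0" "?b H2 \<noteq> 0"
    using linear_coeffs_nonzero hom nz by (auto simp: vec_to_ac_eq_0_iff)
  then have "hyperplane (?b H1) = hyperplane (?b H2)"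
    using line_in_planes[OF U(1,2) sub(1,2,3)] line_in_planes[OF U(1,2) sub(2,1,3)] x by blast
  then have "hyperplane (linear_coeffs H1) = hyperplane (linear_coeffs H2)"
    using rat by blast
  with ne show False by contradiction
qed

section \<open>Point counts as vector counts\<close>

context hermitian_surface
begin

abbreviation surface :: "('a alg_closure ^ 4) set set" where
  "surface \<equiv> proj_points {x. scalar_product x (map_matrix to_ac A *v (\<chi> i. x $ i ^ q)) = 0}"

text \<open>
  Rational points are spanned by rational vectors, but membership in the surface is tested on an
  arbitrary representative; the scalar \<open>s\<close> relates the two.
\<close>

lemma surface_equation:
  "scalar_product (s *s vec_to_ac x) (map_matrix to_ac A *v (\<chi> i. (s *s vec_to_ac x) $ i ^ q))
     = s * s ^ q * to_ac (form x x)"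
  by (simp add: form_def scalar_product_def matrix_vector_mult_def vec_to_ac_def conj_vec_def
      to_ac_sum sum_distrib_left sum_distrib_right power_mult_distrib mult_ac)

lemma span_in_surface_iff:
  assumes "x \<noteq> 0"
  shows "vec.span {vec_to_ac x} \<in> surface \<longleftrightarrow> x \<in> isotropic"
proof
  assume "vec.span {vec_to_ac x} \<in> surface"
  then obtain y where y: "vec.span {vec_to_ac x} = vec.span {y}" "y \<noteq> 0"
      "scalar_product y (map_matrix to_ac A *v (\<chi> i. y $ i ^ q)) = 0"
    unfolding proj_points_def by auto
  obtain s where "s \<noteq> 0" "y = s *s vec_to_ac x"
    using span_singleton_eq[OF y(1,2)] .
  then show "x \<in> isotropic"
    using y(3) by (simp only: surface_equation) (simp add: isotropic_def)
next
  assume "x \<in> isotropic"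
  then show "vec.span {vec_to_ac x} \<in> surface"
    using surface_equation[of 1 x] assms
    unfolding proj_points_def isotropic_def
    by (auto simp: vec_to_ac_eq_0_iff intro!: exI[of _ "vec_to_ac x"])
qed

lemma span_in_zero_set_iff:
  assumes "x \<noteq> 0" "homogeneous d F"
  shows "vec.span {vec_to_ac x} \<in> zero_set F \<longleftrightarrow> eval_mpoly F x = 0"
proof
  assume "vec.span {vec_to_ac x} \<in> zero_set F"
  then obtain y where y: "vec.span {vec_to_ac x} = vec.span {y}" "y \<noteq> 0"
      "eval_mpoly (Poly_Mapping.map to_ac F) y = 0"
    unfolding zero_set_def proj_points_def by auto
  obtain s where "s \<noteq> 0" "y = s *s vec_to_ac x"
    using span_singleton_eq[OF y(1,2)] .
  then show "eval_mpoly F x = 0"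
    using y(3) eval_mpoly_scale[OF homogeneous_map_to_ac[OF assms(2)]]
    by (simp add: eval_mpoly_map_to_ac)
next
  assume "eval_mpoly F x = 0"
  then show "vec.span {vec_to_ac x} \<in> zero_set F"
    using assms(1) unfolding zero_set_def proj_points_def
    by (auto simp: vec_to_ac_eq_0_iff eval_mpoly_map_to_ac intro!: exI[of _ "vec_to_ac x"])
qed

text \<open>
  A positive degree ensures that the zero vector, which belongs to no projective point, is a zero of
  \<open>F\<close>; it accounts for the summand \<open>1\<close>.
\<close>

lemma card_section:
  fixes F :: "(4, 'a) mpoly"
  assumes hom: "homogeneous d F" and d: "d > 0"
  shows "card ({x. eval_mpoly F x = 0} \<inter> isotropic)
       = card (rational_zero_set F \<inter> surface) * (q ^ 2 - 1) + 1"
proof -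
  let ?S = "{x. eval_mpoly F x = 0} \<inter> isotropic"
  have zero: "0 \<in> ?S"
    using eval_mpoly_scale[OF hom, of 0 0] d zero_isotropic by (simp add: power_0_left)
  have image: "rational_zero_set F \<inter> surface = (\<lambda>x. vec.span {vec_to_ac x}) ` (?S - {0})"
    using span_in_zero_set_iff[OF _ hom] span_in_surface_iff
    unfolding rational_zero_set_def rational_points_def vec_to_ac_def[symmetric] by fastforce
  have "t *s x \<in> ?S - {0}" if "t \<noteq> 0" "x \<in> ?S - {0}" for t x
    using that eval_mpoly_scale[OF hom, of t x]
    by (auto simp: isotropic_def form_scale_left form_scale_right vec.scale_eq_0_iff)
  then have "card (?S - {0}) = card (rational_zero_set F \<inter> surface) * (q ^ 2 - 1)"
    unfolding image card_field[symmetric] by (intro card_span_image) auto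
  then show ?thesis
    using card_Suc_Diff1[OF finite zero] by simp
qed

lemma three_planes_section:
  fixes H1 H2 H3 :: "(4, 'a) mpoly"
  assumes "homogeneous 1 H1" "homogeneous 1 H2" "homogeneous 1 H3"
  shows "card ((hyperplane (linear_coeffs H1) \<union> hyperplane (linear_coeffs H2) \<union>
                hyperplane (linear_coeffs H3)) \<inter> isotropic)
       = card (rational_zero_set (H1 * H2 * H3) \<inter> surface) * (q ^ 2 - 1) + 1"
proof -
  have "{x. eval_mpoly (H1 * H2 * H3) x = 0} =
      hyperplane (linear_coeffs H1) \<union> hyperplane (linear_coeffs H2) \<union> hyperplane (linear_coeffs H3)"
    by (auto simp: eval_mpoly_mult eval_mpoly_linear[OF assms(1)] eval_mpoly_linear[OF assms(2)]
        eval_mpoly_linear[OF assms(3)] hyperplane_def)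
  then show ?thesis
    using card_section[OF homogeneous_mult[OF homogeneous_mult[OF assms(1,2)] assms(3)]] by simp
qed

lemma pencil_section:
  fixes H1 H2 H3 :: "(4, 'a) mpoly"
  assumes hom: "homogeneous 1 H1" "homogeneous 1 H2" "homogeneous 1 H3"
    and nz: "H1 \<noteq> 0" "H2 \<noteq> 0" "H3 \<noteq> 0"
    and L: "proj_line L" "L \<subseteq> zero_set H1 \<inter> zero_set H2 \<inter> zero_set H3"
    and n: "n = card (rational_zero_set (H1 * H2 * H3) \<inter> surface)"
  shows "n + 3 * q < 3 * q ^ 3 + q ^ 2 \<or> n \<in> large_pencil_values"
proof -
  have plane: "\<exists>c. c \<noteq> 0 \<and> hyperplane (linear_coeffs H) = polar c"
    if "homogeneous 1 H" "H \<noteq> 0" for H :: "(4, 'a) mpoly"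
  proof -
    obtain c where c: "linear_coeffs H = A *v conj_vec c" by (rule hyperplane_eq_polar)
    then show ?thesis
      using linear_coeffs_nonzero[OF that] mult_conj_eq_0_iff[of c] by (auto simp: polar_def)
  qed
  obtain c where c: "c \<noteq> 0" "hyperplane (linear_coeffs H1) = polar c" using plane hom(1) nz(1) by blast
  obtain d where d: "d \<noteq> 0" "hyperplane (linear_coeffs H2) = polar d" using plane hom(2) nz(2) by blast
  obtain e where e: "e \<noteq> 0" "hyperplane (linear_coeffs H3) = polar e" using plane hom(3) nz(3) by blast
  show ?thesis
  proof (rule pencil_points[OF c(1) d(1) e(1)])
    show "polar c \<inter> polar d \<subseteq> polar e" if "polar c \<noteq> polar d"
      using rational_common_line[OF hom nz(1,2) L] that unfolding c d e .
    show "polar c \<inter> polar e \<subseteq> polar d" if "polar c \<noteq> polar e"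
      using rational_common_line[OF hom(1,3,2) nz(1,3) L(1)] L(2) that unfolding c d e by blast
    show "polar d \<inter> polar e \<subseteq> polar c" if "polar d \<noteq> polar e"
      using rational_common_line[OF hom(2,3,1) nz(2,3) L(1)] L(2) that unfolding c d e by blast
    show "card ((polar c \<union> polar d \<union> polar e) \<inter> isotropic) = n * (q\<^sup>2 - 1) + 1"
      using three_planes_section[OF hom] unfolding c d e n .
  qed
qed

lemma concurrent_planes_section:
  obtains n where "n \<in> section_sizes 3 surface" "q dvd n" "3 * q ^ 3 + q ^ 2 \<le> n + 3 * q"
proof -
  obtain c d e n where nz: "c \<noteq> 0" "d \<noteq> 0" "e \<noteq> 0"
    and n: "q dvd n" "3 * q ^ 3 + q ^ 2 \<le> n + 3 * q"
    "card ((polar c \<union> polar d \<union> polar e) \<inter> isotropic) = n * (q ^ 2 - 1) + 1"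
    by (rule concurrent_planes_points)
  have plane: "\<exists>H :: (4, 'a) mpoly. H \<noteq> 0 \<and> homogeneous 1 H \<and> (\<forall>x. eval_mpoly H x = 0 \<longleftrightarrow> x \<in> polar f)"
    if f: "f \<noteq> 0" for f
  proof -
    obtain H :: "(4, 'a) mpoly" where H: "homogeneous 1 H" "\<And>x. eval_mpoly H x = form x f"
      using exists_linear_mpoly[of "A *v conj_vec f"] by (metis form_def)
    obtain P where "form P f \<noteq> 0"
      using hyperplane_complement_point[of "A *v conj_vec f"] f
      unfolding mult_conj_eq_0_iff form_def by blast
    then have "H \<noteq> 0"
      using H(2)[of P] by (auto simp: eval_mpoly_def)
    then show ?thesis using H by (auto simp: mem_polar)
  qed
  obtain H1 :: "(4, 'a) mpoly" where H1: "H1 \<noteq> 0" "homogeneous 1 H1"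
    "\<And>x. eval_mpoly H1 x = 0 \<longleftrightarrow> x \<in> polar c"
    using plane[OF nz(1)] by blast
  obtain H2 :: "(4, 'a) mpoly" where H2: "H2 \<noteq> 0" "homogeneous 1 H2"
    "\<And>x. eval_mpoly H2 x = 0 \<longleftrightarrow> x \<in> polar d"
    using plane[OF nz(2)] by blast
  obtain H3 :: "(4, 'a) mpoly" where H3: "H3 \<noteq> 0" "homogeneous 1 H3"
    "\<And>x. eval_mpoly H3 x = 0 \<longleftrightarrow> x \<in> polar e"
    using plane[OF nz(3)] by blast
  let ?F = "H1 * H2 * H3"
  have zeros: "{x. eval_mpoly ?F x = 0} = polar c \<union> polar d \<union> polar e"
    by (auto simp: eval_mpoly_mult H1(3) H2(3) H3(3))
  have hom: "homogeneous 3 ?F"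
    using homogeneous_mult[OF homogeneous_mult[OF H1(2) H2(2)] H3(2)] by (simp add: eval_nat_numeral)
  have "?F \<noteq> 0"
    using H1(1) H2(1) H3(1) by simp
  moreover have "card (rational_zero_set ?F \<inter> surface) = n"
    using card_section[OF hom] n(3) q2_gt_1 unfolding zeros by simp
  ultimately have "n \<in> section_sizes 3 surface"
    using hom unfolding section_sizes_def by blast
  then show ?thesis using that n by blast
qed

section \<open>The seven highest values\<close>

text \<open>
  The number \<open>n\<close> from \<open>concurrent_planes_section\<close> is attained but is not among the values \<open>w i\<close>, so it
  lies below all of them. By \<open>pencil_section\<close> the seven distinct values \<open>w i\<close> then belong to the set
  \<open>large_pencil_values\<close>, which has at most six elements.
\<close>

lemma highest_sections_not_pencils:
  assumes w: "highest_values 7 (section_sizes 3 surface) w"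
  shows "\<not> (\<forall>i\<in>{1..7}. \<exists>H1 H2 H3 :: (4, 'a) mpoly.
            H1 \<noteq> 0 \<and> homogeneous 1 H1 \<and> H2 \<noteq> 0 \<and> homogeneous 1 H2 \<and> H3 \<noteq> 0 \<and> homogeneous 1 H3 \<and>
            (\<exists>L. proj_line L \<and> L \<subseteq> zero_set H1 \<inter> zero_set H2 \<inter> zero_set H3) \<and>
            card (rational_zero_set (H1 * H2 * H3) \<inter> surface) = w i)"
proof
  assume all: "\<forall>i\<in>{1..7}. \<exists>H1 H2 H3 :: (4, 'a) mpoly.
            H1 \<noteq> 0 \<and> homogeneous 1 H1 \<and> H2 \<noteq> 0 \<and> homogeneous 1 H2 \<and> H3 \<noteq> 0 \<and> homogeneous 1 H3 \<and>
            (\<exists>L. proj_line L \<and> L \<subseteq> zero_set H1 \<inter> zero_set H2 \<inter> zero_set H3) \<and>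
            card (rational_zero_set (H1 * H2 * H3) \<inter> surface) = w i"
  have w_cases: "w i + 3 * q < 3 * q ^ 3 + q ^ 2 \<or> w i \<in> large_pencil_values"
    if i: "i \<in> {1..7}" for i
  proof -
    obtain H1 H2 H3 :: "(4, 'a) mpoly" and L
      where nz: "H1 \<noteq> 0" "H2 \<noteq> 0" "H3 \<noteq> 0"
        and hom: "homogeneous 1 H1" "homogeneous 1 H2" "homogeneous 1 H3"
        and L: "proj_line L" "L \<subseteq> zero_set H1 \<inter> zero_set H2 \<inter> zero_set H3"
        and wi: "card (rational_zero_set (H1 * H2 * H3) \<inter> surface) = w i"
      using bspec[OF all i] by (elim exE conjE) (rule that)
    show ?thesis by (rule pencil_section[OF hom nz L wi[symmetric]])
  qed
  obtain n where n: "n \<in> section_sizes 3 surface" "q dvd n" "3 * q ^ 3 + q ^ 2 \<le> n + 3 * q"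
    by (rule concurrent_planes_section)
  have "n \<notin> w ` {1..7}"
  proof
    assume "n \<in> w ` {1..7}"
    then have "n + 3 * q < 3 * q ^ 3 + q ^ 2 \<or> n \<in> large_pencil_values"
      using w_cases by blast
    then show False using n(2,3) large_pencil_values_not_dvd by auto
  qed
  then have "n < w i" if "i \<in> {1..7}" for i
    using w n(1) that unfolding highest_values_def by blast
  then have "w ` {1..7} \<subseteq> large_pencil_values"
    using w_cases n(3) by fastforce
  moreover have "finite large_pencil_values"
    by (simp add: large_pencil_values_def)
  ultimately have "card (w ` {1..7}) \<le> 6"
    using card_large_pencil_values card_mono order_trans by blast
  moreover have "inj_on w {1..7}"
  proof (rule linorder_inj_onI)
    show "w i \<noteq> w j" if "i < j" "i \<in> {1..7}" "j \<in> {1..7}" for i j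
      using w that unfolding highest_values_def by fastforce
  qed auto
  ultimately show False by (simp add: card_image)
qed

end

theorem proposition5p7:
  fixes q :: nat
    and V\<^sub>2 :: "('a::{field, finite} alg_closure ^ 4) set set"
    and w :: "nat \<Rightarrow> nat"
  assumes "primepow q" and "q \<ge> 4"
    and "CARD('a) = q ^ 2"
    and "nondegenerate_hermitian_surface q V\<^sub>2"
    and "highest_values 7 (section_sizes 3 V\<^sub>2) w"
  shows "\<not> (\<forall>i\<in>{1..7}. \<exists>H\<^sub>1 H\<^sub>2 H\<^sub>3 :: (4, 'a) mpoly.
            H\<^sub>1 \<noteq> 0 \<and> homogeneous 1 H\<^sub>1 \<and>
            H\<^sub>2 \<noteq> 0 \<and> homogeneous 1 H\<^sub>2 \<and>
            H\<^sub>3 \<noteq> 0 \<and> homogeneous 1 H\<^sub>3 \<and>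
            (\<exists>L. proj_line L \<and> L \<subseteq> zero_set H\<^sub>1 \<inter> zero_set H\<^sub>2 \<inter> zero_set H\<^sub>3) \<and>
            card (rational_zero_set (H\<^sub>1 * H\<^sub>2 * H\<^sub>3) \<inter> V\<^sub>2) = w i)"
proof -
  obtain A :: "'a ^ 4 ^ 4" where A: "invertible A" "transpose A = map_matrix (\<lambda>a. a ^ q) A"
    and V: "V\<^sub>2 = proj_points {x. scalar_product x (map_matrix to_ac A *v (\<chi> i. x $ i ^ q)) = 0}"
    using assms(4) unfolding nondegenerate_hermitian_surface_def by blast
  interpret hermitian_surface q A
    using assms(1-3) A by unfold_locales
  show ?thesis
    using highest_sections_not_pencils assms(5) unfolding V .
qed

end
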